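(* Let $\mathcal F \subsetneq [P_{n+l-1}]_{\ge l}$ be a lower filter, and let $\mathcal F^{\mathsf c} := [P_{n+l-1}]_{\ge l}\setminus \mathcal F$ be its complement (which is an upper filter). Then $G_{l,\mathcal F}$ is a Gröbner basis of $J_{l,\mathcal F^{\mathsf c}}$ with respect to the lexicographic order with $x_1<\cdots<x_n$.
   Context: $K$ is an infinite field, $n,l\ge 1$ are integers, $S=K[x_1,\ldots,x_n]$. $P_m$ is the set of partitions of $m$ (non-increasing sequences of positive integers with sum $m$). The dominance order on $P_m$: for $\lambda=(\lambda_1,\ldots,\lambda_p)$, $\mu=(\mu_1,\ldots,\mu_q)$, $\lambda\unrhd\mu$ (equivalently $\mu\unlhd\lambda$) iff $\lambda_1+\cdots+\lambda_i\ge\mu_1+\cdots+\mu_i$ for $1\le i\le\min\{p,q\}$. $[P_{n+l-1}]_{\ge l}:=\{\lambda\in P_{n+l-1}\mid \lambda_1\ge l\}$, a subposet of $P_{n+l-1}$. A subset $\mathcal F\subset[P_{n+l-1}]_{\ge l}$ is a lower (resp. upper) filter if $\lambda\in\mathcal F$, $\mu\in[P_{n+l-1}]_{\ge l}$ and $\mu\unlhd\lambda$ (resp. $\mu\unrhd\lambda$) imply $\mu\in\mathcal F$. For $\lambda\in[P_{n+l-1}]_{\ge l}$, $\mathrm{Tab}(l,\lambda)$ is the set of bijective fillings $T$ of the squares of the Young diagram of $\lambda$ by the multiset consisting of $l$ copies of $1$ and one copy of each of $2,\ldots,n$, such that no two copies of $1$ lie in the same column. If $a_1,\ldots,a_r$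 are the entries of a column from top to bottom, its difference product is $\prod_{1\le i<j\le r}(x_{a_i}-x_{a_j})$; the Specht polynomial $f_T$ is the product of the difference products of all columns of $T$. $T$ is standard if its columns are strictly increasing from top to bottom and its rows are non-decreasing from left to right; $\mathrm{STab}(l,\lambda)$ is the set of standard $T\in\mathrm{Tab}(l,\lambda)$. For a lower filter $\mathcal F$, $G_{l,\mathcal F}:=\{f_T\mid T\in\mathrm{STab}(l,\lambda),\ \lambda\in\mathcal F\}$ ($G_{l,\emptyset}=\emptyset$). For $\mathbf a=(a_1,\ldots,a_n)\in K^n$, $\Lambda_l(\mathbf a)\in[P_{n+l-1}]_{\ge l}$ is the partition of $n+l-1$ whose parts are the multiplicities of the distinct values in the sequence $(a_1,\ldots,a_1,a_2,\ldots,a_n)$ in which $a_1$ is written $l$ times. For an upper filter $\mathcal F'$, $J_{l,\mathcal F'}$ is the ideal of all $f\in S$ with $f(\mathbf a)=0$ for every $\mathbf a\in K^n$ with $\Lambda_l(\mathbf a)\in\mathcal F'$. *)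

theory Defs
  imports
    "HOL-Library.Multiset"
    "HOL-Library.FuncSet"
    "HOL-Library.Poly_Mapping"
    "HOL-Algebra.Ideal"
begin

text \<open>A monomial is its exponent function, of type \<^typ>\<open>nat \<Rightarrow>\<^sub>0 nat\<close>, and a polynomial is
  a finitely supported coefficient function on monomials; \<open>Poly_Mapping\<close> makes these a
  commutative ring under convolution.\<close>

type_synonym monom = "nat \<Rightarrow>\<^sub>0 nat"
type_synonym 'a mpoly = "monom \<Rightarrow>\<^sub>0 'a"

text \<open>The ring $S = K[x_1,\ldots,x_n]$: only the variables with index in \<open>{1..n}\<close> occur.\<close>

definition poly_ring :: "nat \<Rightarrow> 'a::field mpoly ring" where
  "poly_ring n =
    \<lparr>carrier = {p. \<forall>m \<in> Poly_Mapping.keys p. Poly_Mapping.keys m \<subseteq> {1..n}},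
     mult = (*), one = 1, zero = 0, add = (+)\<rparr>"

definition var :: "nat \<Rightarrow> 'a::field mpoly" where
  "var i = Poly_Mapping.single (Poly_Mapping.single i 1) 1"

definition eval :: "'a::field mpoly \<Rightarrow> (nat \<Rightarrow> 'a) \<Rightarrow> 'a" where
  "eval p a =
    (\<Sum>m \<in> Poly_Mapping.keys p. Poly_Mapping.lookup p m *
      (\<Prod>i \<in> Poly_Mapping.keys m. a i ^ Poly_Mapping.lookup m i))"

text \<open>The lexicographic order with $x_1 < x_2 < \cdots$: the largest variable in which the two
  monomials differ decides. This is not the order instance of \<^type>\<open>poly_mapping\<close>, which
  gives priority to the smallest index.\<close>

definition lex_less :: "monom \<Rightarrow> monom \<Rightarrow> bool" where
  "lex_less m m' \<longleftrightarrow>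
    (\<exists>k. Poly_Mapping.lookup m k < Poly_Mapping.lookup m' k \<and>
         (\<forall>j>k. Poly_Mapping.lookup m j = Poly_Mapping.lookup m' j))"

text \<open>Only meaningful for nonzero polynomials.\<close>

definition lead_monom :: "'a::field mpoly \<Rightarrow> monom" where
  "lead_monom p =
    (THE m. m \<in> Poly_Mapping.keys p \<and>
            (\<forall>m' \<in> Poly_Mapping.keys p. m' \<noteq> m \<longrightarrow> lex_less m' m))"

definition initial_monoms :: "'a::field mpoly set \<Rightarrow> 'a mpoly set" where
  "initial_monoms A = {Poly_Mapping.single (lead_monom f) 1 | f. f \<in> A \<and> f \<noteq> 0}"

definition groebner_basis :: "nat \<Rightarrow> 'a::field mpoly set \<Rightarrow> 'a mpoly set \<Rightarrow> bool" where
  "groebner_basis n G I \<longleftrightarrow>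
    ideal I (poly_ring n) \<and> finite G \<and> G \<subseteq> I \<and>
    genideal (poly_ring n) (initial_monoms G) = genideal (poly_ring n) (initial_monoms I)"

definition partitions :: "nat \<Rightarrow> nat list set" where
  "partitions m = {\<alpha>. sorted_wrt (\<ge>) \<alpha> \<and> (\<forall>x \<in> set \<alpha>. 0 < x) \<and> sum_list \<alpha> = m}"

definition partitions_ge :: "nat \<Rightarrow> nat \<Rightarrow> nat list set" where
  "partitions_ge n l = {\<alpha> \<in> partitions (n + l - 1). \<alpha> \<noteq> [] \<and> l \<le> hd \<alpha>}"

definition dominates :: "nat list \<Rightarrow> nat list \<Rightarrow> bool" where
  "dominates \<alpha> \<beta> \<longleftrightarrow>
    (\<forall>i \<in> {1..min (length \<alpha>) (length \<beta>)}. sum_list (take i \<beta>) \<le> sum_list (take i \<alpha>))"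

definition lower_filter :: "nat \<Rightarrow> nat \<Rightarrow> nat list set \<Rightarrow> bool" where
  "lower_filter n l F \<longleftrightarrow> F \<subseteq> partitions_ge n l \<and>
    (\<forall>\<alpha> \<in> F. \<forall>\<beta> \<in> partitions_ge n l. dominates \<alpha> \<beta> \<longrightarrow> \<beta> \<in> F)"

definition upper_filter :: "nat \<Rightarrow> nat \<Rightarrow> nat list set \<Rightarrow> bool" where
  "upper_filter n l F \<longleftrightarrow> F \<subseteq> partitions_ge n l \<and>
    (\<forall>\<alpha> \<in> F. \<forall>\<beta> \<in> partitions_ge n l. dominates \<beta> \<alpha> \<longrightarrow> \<beta> \<in> F)"

lemma upper_filter_complement:
  "lower_filter n l F \<Longrightarrow> upper_filter n l (partitions_ge n l - F)"
  unfolding lower_filter_def upper_filter_def by blast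

text \<open>Squares are pairs (row, column), both counted from 0.\<close>

definition diagram :: "nat list \<Rightarrow> (nat \<times> nat) set" where
  "diagram \<alpha> = {(i, j). i < length \<alpha> \<and> j < \<alpha> ! i}"

definition tableaux :: "nat \<Rightarrow> nat \<Rightarrow> nat list \<Rightarrow> (nat \<times> nat \<Rightarrow> nat) set" where
  "tableaux n l \<alpha> = {T \<in> extensional (diagram \<alpha>).
     image_mset T (mset_set (diagram \<alpha>)) = replicate_mset l 1 + mset_set {2..n} \<and>
     (\<forall>i i' j. (i, j) \<in> diagram \<alpha> \<and> (i', j) \<in> diagram \<alpha> \<and> T (i, j) = 1 \<and> T (i', j) = 1
        \<longrightarrow> i = i')}"

definition standard_tableaux :: "nat \<Rightarrow> nat \<Rightarrow> nat list \<Rightarrow> (nat \<times> nat \<Rightarrow> nat) set" where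
  "standard_tableaux n l \<alpha> = {T \<in> tableaux n l \<alpha>.
     (\<forall>i i' j. (i, j) \<in> diagram \<alpha> \<and> (i', j) \<in> diagram \<alpha> \<and> i < i' \<longrightarrow> T (i, j) < T (i', j)) \<and>
     (\<forall>i j j'. (i, j) \<in> diagram \<alpha> \<and> (i, j') \<in> diagram \<alpha> \<and> j < j' \<longrightarrow> T (i, j) \<le> T (i, j'))}"

definition difference_product :: "nat list \<Rightarrow> (nat \<times> nat \<Rightarrow> nat) \<Rightarrow> nat \<Rightarrow> 'a::field mpoly" where
  "difference_product \<alpha> T j =
    (\<Prod>(i, i') \<in> {(i, i'). i < i' \<and> (i, j) \<in> diagram \<alpha> \<and> (i', j) \<in> diagram \<alpha>}.
       var (T (i, j)) - var (T (i', j)))"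

definition specht :: "nat list \<Rightarrow> (nat \<times> nat \<Rightarrow> nat) \<Rightarrow> 'a::field mpoly" where
  "specht \<alpha> T = (\<Prod>j < hd \<alpha>. difference_product \<alpha> T j)"

definition specht_set :: "nat \<Rightarrow> nat \<Rightarrow> nat list set \<Rightarrow> 'a::field mpoly set" where
  "specht_set n l F = {specht \<alpha> T | \<alpha> T. \<alpha> \<in> F \<and> T \<in> standard_tableaux n l \<alpha>}"

definition point_seq :: "nat \<Rightarrow> nat \<Rightarrow> (nat \<Rightarrow> 'a) \<Rightarrow> 'a list" where
  "point_seq n l a = replicate l (a 1) @ map a [2..<Suc n]"

definition point_partition :: "nat \<Rightarrow> nat \<Rightarrow> (nat \<Rightarrow> 'a) \<Rightarrow> nat list" where
  "point_partition n l a =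
    rev (sort (map (count_list (point_seq n l a)) (remdups (point_seq n l a))))"

text \<open>Points of $K^n$ are the extensional functions on \<open>{1..n}\<close>.\<close>

definition vanishing_ideal :: "nat \<Rightarrow> nat \<Rightarrow> nat list set \<Rightarrow> 'a::field mpoly set" where
  "vanishing_ideal n l F =
    {f \<in> carrier (poly_ring n).
       \<forall>a \<in> {1..n} \<rightarrow>\<^sub>E UNIV. point_partition n l a \<in> F \<longrightarrow> eval f a = 0}"

end

theory Submission
  imports Defs "HOL-Computational_Algebra.Polynomial"
begin

text \<open>
  Two facts about leading monomials and zeros of Specht polynomials give the theorem.

  First, the polynomials in question lie in the vanishing ideal. If the Specht polynomial of a tableau of shape
  \<open>\<alpha>\<close> does not vanish at a point, the coordinates filled into each column are distinct. Counting boxes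
  column by column shows that \<open>\<alpha>\<close> dominates the partition of the point
  (\<open>specht_nonzero_dominates\<close>). So if \<open>\<alpha>\<close> is in the lower filter, the polynomial vanishes
  at every point whose partition is outside.

  Second, the leading monomial of every nonzero \<open>f\<close> in the vanishing ideal is a multiple of the leading
  monomial of some Specht polynomial of the family (\<open>leading_monomial_above_tableau\<close>). For a standard
  tableau the latter monomial gives each entry its row number (counted from 0) as exponent
  (\<open>leads_specht\<close>). The proof is by induction on the number of variables. Read \<open>f\<close> as a polynomial
  of degree \<open>d\<close> in the last and largest variable; its leading monomial is that of the coefficient \<open>g\<close> of
  the top power, times that power. Count rows from 0.
  Extending a point by one coordinate adds a box to its partition: in the \<open>i\<close>-th row, up to sorting,
  when the \<open>i\<close>-th most frequent value is repeated, and in a new row when a new value is used. If the shape with a box added at row \<open>d\<close> is outside the filter, so are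
  the shapes with a box added at an earlier row, because they dominate it.
  Therefore \<open>f\<close> has more than \<open>d\<close> zeros on the line above the point, and \<open>g\<close> vanishes at
  the point. In other words, \<open>g\<close> lies in the vanishing ideal that belongs to the filter
  of those shapes which a box at row \<open>d\<close> moves into the given filter; adding a box is
  monotone for dominance (\<open>dominates_add_box_mono\<close>), so this is again a lower filter. The induction
  hypothesis provides a standard tableau for \<open>g\<close>, and placing the new largest entry into the
  added box costs at most the exponent \<open>d\<close>.
\<close>

abbreviation "lookup \<equiv> Poly_Mapping.lookup"
abbreviation "keys \<equiv> Poly_Mapping.keys"
abbreviation "single \<equiv> Poly_Mapping.single"

section \<open>Evaluation of polynomials and the polynomial ring\<close>

definition monom_eval :: "monom \<Rightarrow> (nat \<Rightarrow> 'a::field) \<Rightarrow> 'a" where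
  "monom_eval m a = (\<Prod>i\<in>keys m. a i ^ lookup m i)"

text \<open>The support in the definition depends on the monomial; evaluating over any larger finite index set
  makes products of monomials, whose supports differ, comparable.\<close>

lemma monom_eval_superset:
  assumes "finite A" "keys m \<subseteq> A"
  shows "monom_eval m a = (\<Prod>i\<in>A. a i ^ lookup m i)"
  unfolding monom_eval_def
  by (rule prod.mono_neutral_left) (use assms in \<open>auto simp: in_keys_iff\<close>)

lemma monom_eval_add: "monom_eval (m + m') a = monom_eval m a * monom_eval m' a"
proof -
  let ?A = "keys m \<union> keys m'"
  have "monom_eval (m + m') a = (\<Prod>i\<in>?A. a i ^ lookup (m + m') i)"
    by (rule monom_eval_superset) (use keys_add[of m m'] in auto)
  also have "\<dots> = (\<Prod>i\<in>?A. a i ^ lookup m i) * (\<Prod>i\<in>?A. a i ^ lookup m' i)"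
    by (simp add: lookup_add power_add prod.distrib)
  also have "\<dots> = monom_eval m a * monom_eval m' a"
    by (simp add: monom_eval_superset[of ?A])
  finally show ?thesis .
qed

lemma eval_altdef: "eval p a = (\<Sum>m\<in>keys p. lookup p m * monom_eval m a)"
  by (simp add: eval_def monom_eval_def)

lemma eval_0 [simp]: "eval 0 a = 0"
  by (simp add: eval_altdef)

lemma eval_single [simp]: "eval (single m c) a = c * monom_eval m a"
  by (simp add: eval_altdef)

lemma eval_1 [simp]: "eval 1 a = 1"
  by (simp add: eval_altdef monom_eval_def)

lemma eval_var [simp]: "eval (var i) a = a i"
  by (simp add: var_def monom_eval_def)

lemma eval_add: "eval (p + q) a = eval p a + eval q a"
  unfolding eval_altdef by (rule setsum_keys_plus_distrib) (auto simp: algebra_simps)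

lemma eval_sum: "eval (\<Sum>x\<in>A. f x) a = (\<Sum>x\<in>A. eval (f x) a)"
  by (induction A rule: infinite_finite_induct) (auto simp: eval_add)

lemma sum_of_monomials: "(p :: 'a::field mpoly) = (\<Sum>m\<in>keys p. single m (lookup p m))"
proof (rule poly_mapping_eqI)
  fix k
  have "lookup (\<Sum>m\<in>keys p. single m (lookup p m)) k = (\<Sum>m\<in>keys p. if m = k then lookup p m else 0)"
    by (auto simp: lookup_sum lookup_single when_def intro!: sum.cong)
  also have "\<dots> = lookup p k"
    by (simp add: in_keys_iff)
  finally show "lookup p k = lookup (\<Sum>m\<in>keys p. single m (lookup p m)) k" by simp
qed

lemma eval_mult: "eval (p * q) a = eval p a * eval q a"
proof -
  have "p * q = (\<Sum>m\<in>keys p. single m (lookup p m)) * (\<Sum>m\<in>keys q. single m (lookup q m))"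
    by (rule arg_cong2[where f = "(*)"]) (rule sum_of_monomials)+
  then show ?thesis
    by (simp add: sum_product eval_sum mult_single monom_eval_add eval_altdef[of p] eval_altdef[of q]
        mult_ac)
qed

lemma eval_uminus: "eval (- p) a = - eval p a"
  using eval_add[of p "- p" a] by (simp add: eq_neg_iff_add_eq_0 add.commute)

lemma eval_diff: "eval (p - q) a = eval p a - eval q a"
  using eval_add[of p "- q" a] by (simp add: eval_uminus)

lemma eval_prod: "eval (\<Prod>x\<in>A. f x) a = (\<Prod>x\<in>A. eval (f x) a)"
  by (induction A rule: infinite_finite_induct) (auto simp: eval_mult)

lemma carrier_poly_ring:
  "p \<in> carrier (poly_ring n) \<longleftrightarrow> (\<forall>m\<in>keys p. keys m \<subseteq> {1..n})"
  by (simp add: poly_ring_def)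

lemma poly_ring_simps [simp]:
  "mult (poly_ring n) = (*)" "one (poly_ring n) = 1" "zero (poly_ring n) = 0" "add (poly_ring n) = (+)"
  by (simp_all add: poly_ring_def)

lemma carrier_add:
  "p \<in> carrier (poly_ring n) \<Longrightarrow> q \<in> carrier (poly_ring n) \<Longrightarrow> p + q \<in> carrier (poly_ring n)"
  unfolding carrier_poly_ring using keys_add[of p q] by blast

lemma carrier_uminus: "p \<in> carrier (poly_ring n) \<Longrightarrow> - p \<in> carrier (poly_ring n)"
  unfolding carrier_poly_ring by (simp add: in_keys_iff)

lemma carrier_diff:
  "p \<in> carrier (poly_ring n) \<Longrightarrow> q \<in> carrier (poly_ring n) \<Longrightarrow> p - q \<in> carrier (poly_ring n)"
  using carrier_add[of p n "- q"] carrier_uminus[of q n] by simp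

lemma carrier_mult:
  assumes "p \<in> carrier (poly_ring n)" "q \<in> carrier (poly_ring n)"
  shows "p * q \<in> carrier (poly_ring n)"
  unfolding carrier_poly_ring
proof
  fix m assume "m \<in> keys (p * q)"
  then obtain u v where "m = u + v" "u \<in> keys p" "v \<in> keys q"
    using keys_mult[of p q] by blast
  then show "keys m \<subseteq> {1..n}"
    using assms keys_add[of u v] unfolding carrier_poly_ring by blast
qed

lemma carrier_0: "0 \<in> carrier (poly_ring n)"
  and carrier_1: "1 \<in> carrier (poly_ring n)"
  by (simp_all add: carrier_poly_ring)

lemma carrier_prod:
  "(\<And>x. x \<in> A \<Longrightarrow> f x \<in> carrier (poly_ring n)) \<Longrightarrow> (\<Prod>x\<in>A. f x) \<in> carrier (poly_ring n)"
  by (induction A rule: infinite_finite_induct) (auto simp: carrier_mult carrier_1)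

lemma carrier_var: "i \<in> {1..n} \<Longrightarrow> var i \<in> carrier (poly_ring n)"
  by (simp add: carrier_poly_ring var_def)

lemma carrier_single: "keys m \<subseteq> {1..n} \<Longrightarrow> single m c \<in> carrier (poly_ring n)"
  by (simp add: carrier_poly_ring)

lemma cring_poly_ring: "cring (poly_ring n :: 'a::field mpoly ring)"
proof (rule cringI)
  show "abelian_group (poly_ring n :: 'a mpoly ring)"
  proof (rule abelian_groupI)
    fix x :: "'a mpoly" assume "x \<in> carrier (poly_ring n)"
    then show "\<exists>y\<in>carrier (poly_ring n). y \<oplus>\<^bsub>poly_ring n\<^esub> x = \<zero>\<^bsub>poly_ring n\<^esub>"
      by (intro bexI[of _ "- x"]) (auto simp: carrier_uminus)
  qed (auto simp: carrier_add carrier_0 add_ac)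
  show "comm_monoid (poly_ring n :: 'a mpoly ring)"
    by (rule comm_monoidI) (auto simp: carrier_mult carrier_1 mult_ac)
qed (auto simp: distrib_right)

lemma ideal_vanishing_ideal: "ideal (vanishing_ideal n l F :: 'a::field mpoly set) (poly_ring n)"
proof (rule idealI)
  show "ring (poly_ring n :: 'a mpoly ring)" using cring_poly_ring by (rule cring.axioms)
  then interpret R: ring "poly_ring n :: 'a mpoly ring" .
  have neg: "\<ominus>\<^bsub>poly_ring n\<^esub> x = - x" if "x \<in> carrier (poly_ring n)" for x :: "'a mpoly"
    by (rule R.minus_equality) (use that carrier_uminus in auto)
  show "subgroup (vanishing_ideal n l F :: 'a mpoly set) (add_monoid (poly_ring n))"
    by (rule R.add.subgroupI)
       (auto simp: vanishing_ideal_def carrier_0 carrier_add carrier_uminus eval_add eval_uminus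
          neg intro: exI[of _ 0])
qed (auto simp: vanishing_ideal_def carrier_mult eval_mult)

section \<open>The lexicographic order and leading monomials\<close>

text \<open>For a chain of two comparisons the decisive variable is the larger of the two deciding variables.\<close>

lemma lex_less_trans:
  assumes "lex_less u v" "lex_less v w"
  shows "lex_less u w"
proof -
  obtain k where k: "lookup u k < lookup v k" "\<forall>j>k. lookup u j = lookup v j"
    using assms(1) unfolding lex_less_def by blast
  obtain h where h: "lookup v h < lookup w h" "\<forall>j>h. lookup v j = lookup w j"
    using assms(2) unfolding lex_less_def by blast
  have "lookup u (max k h) < lookup w (max k h)"
    using k h by (cases k h rule: linorder_cases) (auto simp: max_def)
  then show ?thesis
    using k h unfolding lex_less_def by (intro exI[of _ "max k h"]) auto
qed

lemma lex_less_irrefl: "\<not> lex_less u u"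
  by (simp add: lex_less_def)

lemma lex_less_total:
  assumes "u \<noteq> v"
  shows "lex_less u v \<or> lex_less v u"
proof -
  define D where "D = {k. lookup u k \<noteq> lookup v k}"
  have "D \<subseteq> keys u \<union> keys v" by (auto simp: D_def in_keys_iff)
  then have fin: "finite D" by (rule finite_subset) simp
  have ne: "D \<noteq> {}" using assms poly_mapping_eqI[of u v] unfolding D_def by blast
  have max: "lookup u (Max D) \<noteq> lookup v (Max D)" using Max_in[OF fin ne] unfolding D_def by blast
  have above: "lookup u j = lookup v j" if "j > Max D" for j
  proof (rule ccontr)
    assume "\<not> ?thesis"
    then have "j \<in> D" by (simp add: D_def)
    then show False using Max_ge[OF fin, of j] that by simp
  qed
  show ?thesis
  proof (cases "lookup u (Max D) < lookup v (Max D)")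
    case True
    then show ?thesis using above unfolding lex_less_def by blast
  next
    case False
    then have "lookup v (Max D) < lookup u (Max D)" using max by simp
    moreover have "\<forall>j>Max D. lookup v j = lookup u j" using above by simp
    ultimately show ?thesis unfolding lex_less_def by blast
  qed
qed

lemma lex_less_add: "lex_less u v \<Longrightarrow> lex_less (u + w) (v + w)"
  by (auto simp: lex_less_def lookup_add)

text \<open>\<open>lead_monom\<close> is a definite description; this relation characterises it without a uniqueness
  obligation and is false for the zero polynomial.\<close>

definition leads :: "'a::field mpoly \<Rightarrow> monom \<Rightarrow> bool" where
  "leads f m \<longleftrightarrow> m \<in> keys f \<and> (\<forall>m'\<in>keys f. m' \<noteq> m \<longrightarrow> lex_less m' m)"

lemma lead_monom_eq:
  assumes "leads f m"
  shows "lead_monom f = m"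
  unfolding lead_monom_def
proof (rule the_equality)
  fix m' assume m': "m' \<in> keys f \<and> (\<forall>x\<in>keys f. x \<noteq> m' \<longrightarrow> lex_less x m')"
  show "m' = m"
  proof (rule ccontr)
    assume "m' \<noteq> m"
    then have "lex_less m m'" "lex_less m' m" using m' assms unfolding leads_def by auto
    then show False using lex_less_trans lex_less_irrefl by blast
  qed
qed (use assms in \<open>simp add: leads_def\<close>)

lemma finite_lex_maximum:
  "finite A \<Longrightarrow> A \<noteq> {} \<Longrightarrow> \<exists>m\<in>A. \<forall>m'\<in>A. m' \<noteq> m \<longrightarrow> lex_less m' m"
proof (induction A rule: finite_ne_induct)
  case (insert x A)
  then obtain m where m: "m \<in> A" "\<forall>m'\<in>A. m' \<noteq> m \<longrightarrow> lex_less m' m" by blast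
  have "x \<noteq> m" using m insert by blast
  then consider "lex_less x m" | "lex_less m x" using lex_less_total by blast
  then show ?case
  proof cases
    case 1
    then show ?thesis using m by blast
  next
    case 2
    have "lex_less m' x" if "m' \<in> A" for m'
      using m(2) that 2 lex_less_trans[of m' m x] by (cases "m' = m") auto
    then show ?thesis by blast
  qed
qed simp

lemma leads_lead_monom: "f \<noteq> 0 \<Longrightarrow> leads f (lead_monom f)"
proof -
  assume "f \<noteq> 0"
  then obtain m where "leads f m"
    using finite_lex_maximum[of "keys f"] unfolding leads_def by auto
  then show ?thesis using lead_monom_eq by metis
qed

lemma leads_nonzero: "leads f m \<Longrightarrow> f \<noteq> 0"
  by (auto simp: leads_def)

text \<open>Split off both leading terms. The product of the leading terms sits at \<open>u + v\<close>, and since the order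
  is compatible with addition every other product of terms is strictly smaller, so nothing cancels it.\<close>

lemma leads_mult:
  assumes p: "leads p u" and q: "leads q v"
  shows "leads (p * q) (u + v)"
proof -
  define p' where "p' = p - single u (lookup p u)"
  define q' where "q' = q - single v (lookup q v)"
  have keys_p': "lex_less x u" if "x \<in> keys p'" for x
    using that p unfolding p'_def leads_def
    by (auto simp: in_keys_iff lookup_minus lookup_single when_def split: if_splits)
  have keys_q': "lex_less x v" if "x \<in> keys q'" for x
    using that q unfolding q'_def leads_def
    by (auto simp: in_keys_iff lookup_minus lookup_single when_def split: if_splits)
  have less: "lex_less (x + y) (u + v)"
    if "x = u \<or> lex_less x u" "y = v \<or> lex_less y v" "x \<noteq> u \<or> y \<noteq> v" for x y
    using that lex_less_add[of x u y] lex_less_add[of y v u] lex_less_trans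
    by (metis add.commute)
  have keys_less: "lex_less m (u + v)" if m: "m \<in> keys (p * q)" "m \<noteq> u + v" for m
  proof -
    obtain x y where "m = x + y" "x \<in> keys p" "y \<in> keys q"
      using m keys_mult[of p q] by blast
    then show ?thesis using m less[of x y] p q unfolding leads_def by blast
  qed
  have "p * q = single u (lookup p u) * single v (lookup q v)
      + (single u (lookup p u) * q' + p' * q)"
    by (simp add: p'_def q'_def algebra_simps)
  moreover have "lookup (single u (lookup p u) * q') (u + v) = 0"
  proof (rule ccontr)
    assume "\<not> ?thesis"
    then obtain x y where "u + v = x + y" "x \<in> keys (single u (lookup p u))" "y \<in> keys q'"
      using keys_mult[of "single u (lookup p u)" q'] by (auto simp: in_keys_iff)
    then show False using keys_q' lex_less_irrefl by (auto split: if_splits)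
  qed
  moreover have "lookup (p' * q) (u + v) = 0"
  proof (rule ccontr)
    assume "\<not> ?thesis"
    then obtain x y where *: "u + v = x + y" "x \<in> keys p'" "y \<in> keys q"
      using keys_mult[of p' q] by (auto simp: in_keys_iff)
    then show False using less[of x y] keys_p'[of x] q lex_less_irrefl unfolding leads_def by metis
  qed
  ultimately have "lookup (p * q) (u + v) = lookup p u * lookup q v"
    by (simp add: lookup_add mult_single)
  then have "u + v \<in> keys (p * q)"
    using p q by (simp add: in_keys_iff leads_def)
  then show ?thesis using keys_less by (simp add: leads_def)
qed

lemma leads_1: "leads 1 0"
  by (simp add: leads_def)

lemma leads_prod:
  "(\<And>x. x \<in> A \<Longrightarrow> leads (f x) (m x)) \<Longrightarrow> leads (\<Prod>x\<in>A. f x) (\<Sum>x\<in>A. m x)"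
  by (induction A rule: infinite_finite_induct) (auto simp: leads_1 leads_mult)

lemma leads_var_diff:
  assumes "i < j"
  shows "leads (var i - var j :: 'a::field mpoly) (single j 1)"
proof -
  have ne: "single i (1::nat) \<noteq> single j 1"
    using assms by (metis lookup_single_eq lookup_single_not_eq nat_neq_iff one_neq_zero)
  have "lex_less (single i 1) (single j 1)"
    using assms unfolding lex_less_def
    by (intro exI[of _ j]) (auto simp: lookup_single when_def)
  then show ?thesis
    using ne unfolding leads_def var_def
    by (auto simp: in_keys_iff lookup_minus lookup_single when_def split: if_splits)
qed

section \<open>Coefficients with respect to the last variable\<close>

text \<open>The coefficient of $x_n^d$ when \<open>f\<close> is read as a polynomial in $x_n$.\<close>

definition last_coeff :: "nat \<Rightarrow> nat \<Rightarrow> 'a::field mpoly \<Rightarrow> 'a mpoly" where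
  "last_coeff n d f =
    (\<Sum>m \<in> {m \<in> keys f. lookup m n = d}. single (m - single n d) (lookup f m))"

lemma minus_single_add: "lookup m n = d \<Longrightarrow> m - single n d + single n d = (m :: monom)"
  by (rule poly_mapping_eqI) (auto simp: lookup_add lookup_minus lookup_single when_def)

lemma lookup_last_coeff:
  assumes "lookup m n = 0"
  shows "lookup (last_coeff n d f) m = lookup f (m + single n d)"
proof -
  have iff: "x - single n d = m \<longleftrightarrow> x = m + single n d" if "lookup x n = d" for x
    using minus_single_add[OF that] by auto
  have "lookup (last_coeff n d f) m
      = (\<Sum>x \<in> {x \<in> keys f. lookup x n = d}. if x = m + single n d then lookup f x else 0)"
    unfolding last_coeff_def lookup_sum
    by (rule sum.cong) (auto simp: lookup_single when_def iff)
  also have "\<dots> = lookup f (m + single n d)"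
    using assms by (simp add: in_keys_iff lookup_add)
  finally show ?thesis .
qed

lemma keys_last_coeff:
  assumes "m \<in> keys (last_coeff n d f)"
  shows "lookup m n = 0" "m + single n d \<in> keys f"
proof -
  have "m \<in> (\<Union>x \<in> {x \<in> keys f. lookup x n = d}. keys (single (x - single n d) (lookup f x)))"
    using assms unfolding last_coeff_def by (rule subsetD[OF keys_sum])
  then obtain x where x: "x \<in> keys f" "lookup x n = d" "m = x - single n d"
    by (auto split: if_splits)
  then show "lookup m n = 0" by (simp add: lookup_minus)
  show "m + single n d \<in> keys f" using x minus_single_add[OF x(2)] by simp
qed

lemma last_coeff_carrier:
  assumes "f \<in> carrier (poly_ring (Suc n))"
  shows "last_coeff (Suc n) d f \<in> carrier (poly_ring n)"
  unfolding carrier_poly_ring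
proof (intro ballI subsetI)
  fix m i assume m: "m \<in> keys (last_coeff (Suc n) d f)" and i: "i \<in> keys m"
  have "keys (m + single (Suc n) d) \<subseteq> {1..Suc n}"
    using assms keys_last_coeff(2)[OF m] by (auto simp: carrier_poly_ring)
  moreover have "i \<in> keys (m + single (Suc n) d)"
    using i by (auto simp: in_keys_iff lookup_add)
  moreover have "i \<noteq> Suc n"
    using keys_last_coeff(1)[OF m] i by (auto simp: in_keys_iff)
  ultimately show "i \<in> {1..n}"
    by (metis atLeastAtMost_iff le_SucE subsetD)
qed

text \<open>Among monomials with the same exponent of $x_n$, dividing by that power of $x_n$ preserves the
  lexicographic order.\<close>

lemma leads_last_coeff:
  assumes "leads f m"
  shows "leads (last_coeff n (lookup m n) f) (m - single n (lookup m n))"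
proof -
  let ?d = "lookup m n"
  have "lookup (last_coeff n ?d f) (m - single n ?d) = lookup f m"
    by (subst lookup_last_coeff) (auto simp: lookup_minus minus_single_add)
  then have "m - single n ?d \<in> keys (last_coeff n ?d f)"
    using assms by (simp add: in_keys_iff leads_def)
  moreover have "lex_less x (m - single n ?d)"
    if x: "x \<in> keys (last_coeff n ?d f)" and ne: "x \<noteq> m - single n ?d" for x
  proof -
    have "x + single n ?d \<noteq> m" using ne by (metis add_diff_cancel_right')
    then have "lex_less (x + single n ?d) m"
      using keys_last_coeff(2)[OF x] assms by (simp add: leads_def)
    then obtain k where k: "lookup (x + single n ?d) k < lookup m k"
      "\<forall>j>k. lookup (x + single n ?d) j = lookup m j" unfolding lex_less_def by blast
    show ?thesis unfolding lex_less_def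
      by (rule exI[of _ k])
         (use k keys_last_coeff(1)[OF x] in \<open>auto simp: lookup_add lookup_minus lookup_single when_def\<close>)
  qed
  ultimately show ?thesis by (simp add: leads_def)
qed

text \<open>Because $x_n$ is the largest variable of the ring, the leading monomial carries the full $x_n$-degree. Hence the coefficient extracted by
  \<open>leads_last_coeff\<close> is the leading coefficient of \<open>f\<close> as a polynomial in $x_n$.\<close>

lemma degree_le_leads:
  assumes "f \<in> carrier (poly_ring n)" "leads f m" "x \<in> keys f"
  shows "lookup x n \<le> lookup m n"
proof (rule ccontr)
  assume gt: "\<not> ?thesis"
  have zero: "lookup y j = 0" if "y \<in> keys f" "j > n" for y j
    using assms(1) that by (force simp: carrier_poly_ring in_keys_iff)
  have "lex_less m x"
    using gt zero assms unfolding lex_less_def leads_def by (intro exI[of _ n]) auto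
  moreover have "x = m \<or> lex_less x m" using assms by (auto simp: leads_def)
  ultimately show False using lex_less_irrefl lex_less_trans by blast
qed

lemma eval_last_coeff:
  assumes f: "f \<in> carrier (poly_ring (Suc n))"
    and deg: "\<forall>m\<in>keys f. lookup m (Suc n) \<le> d"
  shows "eval f (a(Suc n := x)) = (\<Sum>k\<le>d. eval (last_coeff (Suc n) k f) a * x ^ k)"
proof -
  have ev: "monom_eval m (a(Suc n := x)) =
      monom_eval (m - single (Suc n) (lookup m (Suc n))) a * x ^ lookup m (Suc n)" for m
  proof -
    let ?m = "m - single (Suc n) (lookup m (Suc n))"
    have "monom_eval m (a(Suc n := x)) = monom_eval (?m + single (Suc n) (lookup m (Suc n))) (a(Suc n := x))"
      by (simp add: minus_single_add)
    also have "\<dots> = monom_eval ?m (a(Suc n := x)) * x ^ lookup m (Suc n)"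
      by (simp add: monom_eval_add monom_eval_superset[of "{Suc n}" "single _ _"])
    also have "monom_eval ?m (a(Suc n := x)) = monom_eval ?m a"
      unfolding monom_eval_def by (rule prod.cong) (auto simp: in_keys_iff lookup_minus)
    finally show ?thesis .
  qed
  have "(\<Sum>k\<le>d. eval (last_coeff (Suc n) k f) a * x ^ k)
      = (\<Sum>k\<le>d. \<Sum>m \<in> {m \<in> keys f. lookup m (Suc n) = k}. lookup f m * monom_eval m (a(Suc n := x)))"
    by (simp add: last_coeff_def eval_sum sum_distrib_left ev mult_ac)
  also have "\<dots> = (\<Sum>m\<in>keys f. lookup f m * monom_eval m (a(Suc n := x)))"
    by (rule sum.group) (use deg in auto)
  finally show ?thesis by (simp add: eval_altdef)
qed

text \<open>Fixing the first \<open>n\<close> coordinates gives a univariate polynomial whose degree is at most the exponent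
  of $x_{n+1}$ in the leading monomial. With more roots than that it is zero, and so is its top coefficient.\<close>

lemma last_coeff_vanishes:
  fixes f :: "'a::field mpoly"
  assumes f: "f \<in> carrier (poly_ring (Suc n))"
    and lead: "leads f m"
    and roots: "\<And>x. x \<in> X \<Longrightarrow> eval f (a(Suc n := x)) = 0"
    and X: "infinite X \<or> lookup m (Suc n) < card X"
  shows "eval (last_coeff (Suc n) (lookup m (Suc n)) f) a = 0"
proof -
  let ?d = "lookup m (Suc n)"
  define p where "p = (\<Sum>k\<le>?d. monom (eval (last_coeff (Suc n) k f) a) k)"
  have poly_p: "poly p x = eval f (a(Suc n := x))" for x
    using eval_last_coeff[OF f, of ?d] degree_le_leads[OF f lead]
    by (simp add: p_def poly_sum poly_monom)
  have "degree p \<le> ?d"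
    unfolding p_def by (intro degree_sum_le) (auto intro: order_trans[OF degree_monom_le])
  have "p = 0"
  proof (rule ccontr)
    assume "p \<noteq> 0"
    have sub: "X \<subseteq> {x. poly p x = 0}" using roots poly_p by auto
    have fin: "finite {x. poly p x = 0}" using \<open>p \<noteq> 0\<close> by (rule poly_roots_finite)
    have "card X \<le> ?d"
      using card_mono[OF fin sub] card_poly_roots_bound[OF \<open>p \<noteq> 0\<close>] \<open>degree p \<le> ?d\<close> by linarith
    then show False using X finite_subset[OF sub fin] by simp
  qed
  moreover have "coeff p ?d = eval (last_coeff (Suc n) ?d f) a"
    by (simp add: p_def coeff_sum coeff_monom)
  ultimately show ?thesis by simp
qed

section \<open>Adding a box to a partition\<close>

text \<open>Rows are numbered from 0 and continued by empty rows, so that a box may also be added in a new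
  row below the diagram.\<close>

abbreviation part :: "nat list \<Rightarrow> nat \<Rightarrow> nat" where
  "part \<equiv> nth_default 0"

text \<open>Lengthening row \<open>i\<close> of a partition and sorting again lengthens the first row of the same length as
  row \<open>i\<close>. This is the row where the new box really lands.\<close>

definition corner :: "nat list \<Rightarrow> nat \<Rightarrow> nat" where
  "corner \<alpha> i = (LEAST k. part \<alpha> k = part \<alpha> i)"

definition add_box :: "nat \<Rightarrow> nat list \<Rightarrow> nat list" where
  "add_box i \<alpha> = take (corner \<alpha> i) \<alpha> @ Suc (part \<alpha> (corner \<alpha> i)) # drop (Suc (corner \<alpha> i)) \<alpha>"

lemma part_antimono:
  assumes "sorted_wrt (\<ge>) \<alpha>" "i \<le> j"
  shows "part \<alpha> j \<le> part \<alpha> i"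
  using assms by (cases "i = j") (auto simp: nth_default_def sorted_wrt_iff_nth_less)

lemma part_eq_0_iff: "\<alpha> \<in> partitions N \<Longrightarrow> part \<alpha> i = 0 \<longleftrightarrow> length \<alpha> \<le> i"
  by (auto simp: nth_default_def partitions_def)

lemma part_corner: "part \<alpha> (corner \<alpha> i) = part \<alpha> i"
  unfolding corner_def by (rule LeastI) simp

lemma corner_le: "corner \<alpha> i \<le> i"
  unfolding corner_def by (rule Least_le) simp

lemma corner_least: "part \<alpha> k = part \<alpha> i \<Longrightarrow> corner \<alpha> i \<le> k"
  unfolding corner_def by (rule Least_le)

lemma corner_le_length: "corner \<alpha> i \<le> length \<alpha>"
  using corner_le[of \<alpha> i] corner_least[of \<alpha> "length \<alpha>" i]
  by (cases "i < length \<alpha>") (auto simp: nth_default_def)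

text \<open>Rows above the corner are strictly longer, so that the corner row can be lengthened without
  destroying monotonicity.\<close>

lemma part_less_of_less_corner:
  assumes "sorted_wrt (\<ge>) \<alpha>" "k < corner \<alpha> i"
  shows "part \<alpha> i < part \<alpha> k"
proof -
  have "part \<alpha> k \<noteq> part \<alpha> i" using corner_least assms(2) by (meson leD)
  moreover have "part \<alpha> i \<le> part \<alpha> k"
    using assms corner_le[of \<alpha> i] by (intro part_antimono) auto
  ultimately show ?thesis by simp
qed

lemma length_add_box: "length (add_box i \<alpha>) = max (length \<alpha>) (Suc (corner \<alpha> i))"
  using corner_le_length[of \<alpha> i] by (simp add: add_box_def)

lemma part_add_box: "part (add_box i \<alpha>) k = part \<alpha> k + (if k = corner \<alpha> i then 1 else 0)"
proof -
  consider "k < corner \<alpha> i" | "k = corner \<alpha> i" | j where "k = Suc (corner \<alpha> i + j)"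
    by (metis less_imp_Suc_add linorder_neqE_nat)
  then show ?thesis
    using corner_le_length[of \<alpha> i]
    by cases (auto simp: add_box_def nth_default_def nth_append)
qed

text \<open>Up to order, adding a box only increments the part with index \<open>i\<close>; this is what identifies the result
  with the partition of a point that is extended by one coordinate.\<close>

lemma mset_add_box:
  assumes "\<alpha> \<in> partitions N"
  shows "mset (add_box i \<alpha>) = (if i < length \<alpha> then add_mset (Suc (\<alpha> ! i)) (mset \<alpha> - {#\<alpha> ! i#})
    else add_mset 1 (mset \<alpha>))"
proof (cases "i < length \<alpha>")
  case True
  let ?k = "corner \<alpha> i"
  have k: "?k < length \<alpha>" using corner_le[of \<alpha> i] True by simp
  have eq: "\<alpha> ! ?k = \<alpha> ! i" using part_corner[of \<alpha> i] k True by (simp add: nth_default_def)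
  have "mset \<alpha> = mset (take ?k \<alpha> @ \<alpha> ! ?k # drop (Suc ?k) \<alpha>)"
    using id_take_nth_drop[OF k] by simp
  then show ?thesis using True k eq by (simp add: add_box_def nth_default_def)
next
  case False
  then have "part \<alpha> (corner \<alpha> i) = 0" using part_corner by (simp add: nth_default_def)
  then have "corner \<alpha> i = length \<alpha>"
    using part_eq_0_iff[OF assms] corner_le_length[of \<alpha> i] by (meson le_antisym)
  then show ?thesis using False by (simp add: add_box_def nth_default_def)
qed

lemma sum_list_take: "sum_list (take k \<alpha>) = (\<Sum>j<k. part \<alpha> j)"
proof (induction k)
  case (Suc k)
  then show ?case
    by (cases "k < length \<alpha>") (auto simp: take_Suc_conv_app_nth nth_default_def)
qed simp

lemma sum_list_take_add_box:
  "sum_list (take k (add_box i \<alpha>)) = sum_list (take k \<alpha>) + (if corner \<alpha> i < k then 1 else 0)"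
  by (simp add: sum_list_take part_add_box sum.distrib)

lemma add_box_partition:
  assumes "\<alpha> \<in> partitions N"
  shows "add_box i \<alpha> \<in> partitions (Suc N)"
proof -
  let ?\<beta> = "add_box i \<alpha>"
  have sorted: "sorted_wrt (\<ge>) \<alpha>" using assms by (simp add: partitions_def)
  have "part ?\<beta> y \<le> part ?\<beta> x" if "x < y" for x y
    using part_antimono[OF sorted, of x y] part_less_of_less_corner[OF sorted, of x i] part_corner[of \<alpha> i] that
    by (auto simp: part_add_box)
  note antimono = this
  have "?\<beta> ! y \<le> ?\<beta> ! x" if "x < y" "y < length ?\<beta>" for x y
    using antimono[OF that(1)] that nth_default_nth[of x ?\<beta> 0] nth_default_nth[of y ?\<beta> 0] by simp
  then have "sorted_wrt (\<ge>) ?\<beta>"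
    by (simp add: sorted_wrt_iff_nth_less)
  moreover have "\<forall>x\<in>set ?\<beta>. 0 < x"
    using assms by (auto simp: add_box_def partitions_def dest: in_set_takeD in_set_dropD)
  moreover have "sum_list ?\<beta> = Suc N"
  proof -
    have "sum_list ?\<beta> = sum_list (take (length ?\<beta>) ?\<beta>)" by simp
    also have "\<dots> = sum_list (take (length ?\<beta>) \<alpha>) + 1"
      by (subst sum_list_take_add_box) (simp add: length_add_box)
    also have "\<dots> = Suc N" using assms by (simp add: length_add_box partitions_def)
    finally show ?thesis .
  qed
  ultimately show ?thesis by (simp add: partitions_def)
qed

lemma add_box_nonempty [simp]: "add_box i \<alpha> \<noteq> []"
  by (simp add: add_box_def)

lemma hd_eq_part: "\<alpha> \<noteq> [] \<Longrightarrow> hd \<alpha> = part \<alpha> 0"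
  by (simp add: nth_default_def hd_conv_nth)

lemma add_box_partitions_ge:
  assumes "\<alpha> \<in> partitions_ge n l" "l \<ge> 1"
  shows "add_box i \<alpha> \<in> partitions_ge (Suc n) l"
  using assms add_box_partition[of \<alpha> "n + l - 1" i]
  by (auto simp: partitions_ge_def hd_eq_part part_add_box)

section \<open>The dominance order\<close>

text \<open>The definition compares partial sums only up to the shorter length. For partitions of the same number
  this forces the dominating one to be at most as long as the other, and beyond its length its partial sums
  are the whole number.\<close>

lemma dominates_iff:
  assumes \<alpha>: "\<alpha> \<in> partitions N" and \<beta>: "\<beta> \<in> partitions N"
  shows "dominates \<alpha> \<beta> \<longleftrightarrow> (\<forall>k. sum_list (take k \<beta>) \<le> sum_list (take k \<alpha>))"
proof
  have total: "sum_list (take k \<gamma>) \<le> N" if "\<gamma> \<in> partitions N" for k \<gamma>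
    using that sum_list_append[of "take k \<gamma>" "drop k \<gamma>"] by (simp add: partitions_def)
  have full: "sum_list (take k \<gamma>) = N" if "\<gamma> \<in> partitions N" "length \<gamma> \<le> k" for k \<gamma>
    using that by (simp add: partitions_def)
  assume dom: "dominates \<alpha> \<beta>"
  show "\<forall>k. sum_list (take k \<beta>) \<le> sum_list (take k \<alpha>)"
  proof
    fix k
    consider "k \<le> length \<alpha>" "k \<le> length \<beta>" | "length \<alpha> \<le> k" | "length \<beta> \<le> k" "length \<beta> \<le> length \<alpha>"
      by linarith
    then show "sum_list (take k \<beta>) \<le> sum_list (take k \<alpha>)"
    proof cases
      case 1
      then show ?thesis using dom by (cases "k = 0") (auto simp: dominates_def)
    next
      case 2
      then show ?thesis using full[OF \<alpha>] total[OF \<beta>] by simp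
    next
      case 3
      have "N \<le> sum_list (take (length \<beta>) \<alpha>)"
      proof (cases "length \<beta> = 0")
        case False
        then have "length \<beta> \<in> {1..min (length \<alpha>) (length \<beta>)}" using 3 by (simp add: Suc_le_eq)
        then have "sum_list (take (length \<beta>) \<beta>) \<le> sum_list (take (length \<beta>) \<alpha>)"
          using dom unfolding dominates_def by blast
        then show ?thesis using full[OF \<beta> order.refl] by linarith
      qed (use full[OF \<beta>, of 0] in simp)
      also have "\<dots> \<le> sum_list (take k \<alpha>)"
        unfolding sum_list_take using 3 by (intro sum_mono2) auto
      finally show ?thesis using full[OF \<beta>] 3 by simp
    qed
  qed
qed (simp add: dominates_def)

text \<open>A box in a higher row enters the partial sums earlier.\<close>

lemma dominates_add_box_antimono:
  assumes \<alpha>: "\<alpha> \<in> partitions N" and ij: "i \<le> j"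
  shows "dominates (add_box i \<alpha>) (add_box j \<alpha>)"
proof -
  have sorted: "sorted_wrt (\<ge>) \<alpha>" using \<alpha> by (simp add: partitions_def)
  have "corner \<alpha> i \<le> corner \<alpha> j"
  proof (cases "i \<le> corner \<alpha> j")
    case True
    then show ?thesis using corner_le order_trans by blast
  next
    case False
    then have "part \<alpha> i \<le> part \<alpha> (corner \<alpha> j)" by (intro part_antimono[OF sorted]) simp
    moreover have "part \<alpha> j \<le> part \<alpha> i" using ij by (rule part_antimono[OF sorted])
    ultimately show ?thesis using part_corner[of \<alpha> j] by (intro corner_least) simp
  qed
  then show ?thesis by (auto simp: dominates_def sum_list_take_add_box)
qed

text \<open>The only danger is a partial sum \<open>k\<close> where the two shapes agree and only \<open>\<beta>\<close> has received its box.
  There the rows of \<open>\<beta>\<close> between its corner and \<open>i\<close> all have a common length, and comparing the partial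
  sums at \<open>k - 1\<close>, \<open>k\<close> and \<open>Suc i\<close> shows that the rows of \<open>\<alpha>\<close> from \<open>k - 1\<close> to \<open>i\<close> have that length too.
  So the corner of \<open>\<alpha>\<close> lies above row \<open>k\<close>, a contradiction.\<close>

lemma dominates_add_box_mono:
  assumes \<alpha>: "\<alpha> \<in> partitions N" and \<beta>: "\<beta> \<in> partitions N" and dom: "dominates \<alpha> \<beta>"
  shows "dominates (add_box i \<alpha>) (add_box i \<beta>)"
proof -
  let ?S = "\<lambda>\<gamma> k. \<Sum>j<k. part \<gamma> j"
  have sa: "sorted_wrt (\<ge>) \<alpha>" and sb: "sorted_wrt (\<ge>) \<beta>"
    using \<alpha> \<beta> by (simp_all add: partitions_def)
  have le: "?S \<beta> k \<le> ?S \<alpha> k" for k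
    using dom dominates_iff[OF \<alpha> \<beta>] by (simp add: sum_list_take)
  have strict: "?S \<beta> k < ?S \<alpha> k" if k: "corner \<beta> i < k" "k \<le> corner \<alpha> i" for k
  proof (rule ccontr)
    assume "\<not> ?thesis"
    then have eq: "?S \<alpha> k = ?S \<beta> k" using le[of k] by simp
    obtain k' where k': "k = Suc k'" using k by (cases k) auto
    have "k \<le> i" using k corner_le[of \<alpha> i] by simp
    have c: "part \<beta> j = part \<beta> i" if "corner \<beta> i \<le> j" "j \<le> i" for j
      using part_antimono[OF sb that(1)] part_antimono[OF sb that(2)] part_corner[of \<beta> i] by simp
    have "part \<alpha> k' \<le> part \<beta> i"
      using eq le[of k'] c[of k'] k k' \<open>k \<le> i\<close> by simp
    then have small: "part \<alpha> j \<le> part \<beta> i" if "k' \<le> j" for j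
      using part_antimono[OF sa that] by simp
    have "(\<Sum>j\<in>{k..i}. part \<beta> i) \<le> (\<Sum>j\<in>{k..i}. part \<alpha> j)"
    proof -
      have split: "?S \<gamma> (Suc i) = ?S \<gamma> k + (\<Sum>j\<in>{k..i}. part \<gamma> j)" for \<gamma>
      proof -
        have eq: "{..<Suc i} = {..<k} \<union> {k..i}" using \<open>k \<le> i\<close> by auto
        show ?thesis unfolding eq by (rule sum.union_disjoint) auto
      qed
      have "(\<Sum>j\<in>{k..i}. part \<beta> i) = (\<Sum>j\<in>{k..i}. part \<beta> j)"
        using k by (intro sum.cong) (auto intro!: c[symmetric])
      then show ?thesis using le[of "Suc i"] split[of \<alpha>] split[of \<beta>] eq by linarith
    qed
    moreover have "(\<Sum>j\<in>{k..i}. part \<alpha> j) < (\<Sum>j\<in>{k..i}. part \<beta> i)" if "part \<alpha> i < part \<beta> i"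
    proof (rule sum_strict_mono_ex1)
      show "\<forall>j\<in>{k..i}. part \<alpha> j \<le> part \<beta> i" using small k' by simp
      show "\<exists>j\<in>{k..i}. part \<alpha> j < part \<beta> i" using that \<open>k \<le> i\<close> by (intro bexI[of _ i]) auto
    qed simp
    ultimately have "part \<beta> i \<le> part \<alpha> i" by linarith
    then have "part \<alpha> k' = part \<alpha> i"
      using \<open>part \<alpha> k' \<le> part \<beta> i\<close> part_antimono[OF sa, of k' i] \<open>k \<le> i\<close> k' by simp
    then show False using corner_least[of \<alpha> k' i] k k' by simp
  qed
  have "sum_list (take k (add_box i \<beta>)) \<le> sum_list (take k (add_box i \<alpha>))" for k
    unfolding sum_list_take_add_box unfolding sum_list_take
    using le[of k] strict[of k] by (auto simp: not_less)
  then show ?thesis by (simp add: dominates_def)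
qed

text \<open>The filter that governs the coefficient of $x_{n+1}^d$ in the induction on the number of variables.\<close>

definition box_residual :: "nat \<Rightarrow> nat \<Rightarrow> nat \<Rightarrow> nat list set \<Rightarrow> nat list set" where
  "box_residual n l d F = {\<alpha> \<in> partitions_ge n l. add_box d \<alpha> \<in> F}"

lemma lower_filter_box_residual:
  assumes "lower_filter (Suc n) l F" "l \<ge> 1"
  shows "lower_filter n l (box_residual n l d F)"
  unfolding lower_filter_def
proof (intro conjI ballI impI)
  show "box_residual n l d F \<subseteq> partitions_ge n l" by (auto simp: box_residual_def)
  fix \<alpha> \<beta>
  assume \<alpha>: "\<alpha> \<in> box_residual n l d F" and \<beta>: "\<beta> \<in> partitions_ge n l" and "dominates \<alpha> \<beta>"
  then have "dominates (add_box d \<alpha>) (add_box d \<beta>)"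
    by (intro dominates_add_box_mono) (auto simp: box_residual_def partitions_ge_def)
  then show "\<beta> \<in> box_residual n l d F"
    using \<alpha> \<beta> assms add_box_partitions_ge[of \<beta> n l d]
    unfolding box_residual_def lower_filter_def by blast
qed

section \<open>The partition of a point\<close>

definition value_partition :: "'a list \<Rightarrow> nat list" where
  "value_partition xs = rev (sort (map (count_list xs) (remdups xs)))"

lemma point_partition_eq: "point_partition n l a = value_partition (point_seq n l a)"
  by (simp add: point_partition_def value_partition_def)

lemma sorted_value_partition: "sorted_wrt (\<ge>) (value_partition xs)"
  by (simp add: value_partition_def sorted_wrt_rev)

lemma mset_value_partition:
  "mset (value_partition xs) = image_mset (count_list xs) (mset_set (set xs))"
proof -
  have "mset (remdups xs) = mset_set (set xs)"
    using mset_set_set[of "remdups xs"] by simp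
  then show ?thesis by (simp add: value_partition_def)
qed

lemma partition_eqI:
  assumes "sorted_wrt (\<ge>) \<alpha>" "sorted_wrt (\<ge>) \<beta>" "mset \<alpha> = mset \<beta>"
  shows "\<alpha> = (\<beta> :: nat list)"
proof -
  have "sorted (rev \<alpha>)" "sorted (rev \<beta>)" "mset (rev \<alpha>) = mset (rev \<beta>)"
    using assms by (simp_all add: sorted_wrt_rev)
  then have "rev \<alpha> = rev \<beta>" by (metis properties_for_sort sorted_sort_id)
  then show ?thesis by simp
qed

text \<open>The parts listed together with the values that they count, so that the value with the \<open>i\<close>-th largest
  multiplicity can be addressed.\<close>

lemma value_partition_obtain:
  obtains vs where "distinct vs" "set vs = set xs" "value_partition xs = map (count_list xs) vs"
proof
  let ?vs = "rev (sort_key (count_list xs) (remdups xs))"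
  show "distinct ?vs" "set ?vs = set xs" by simp_all
  show "value_partition xs = map (count_list xs) ?vs"
  proof (rule partition_eqI)
    show "sorted_wrt (\<ge>) (map (count_list xs) ?vs)"
      using sorted_sort_key[of "count_list xs" "remdups xs"] by (simp add: rev_map[symmetric] sorted_wrt_rev)
    show "mset (value_partition xs) = mset (map (count_list xs) ?vs)"
      by (simp add: value_partition_def)
  qed (rule sorted_value_partition)
qed

lemma value_partition_partition: "value_partition xs \<in> partitions (length xs)"
proof -
  have "sum_list (value_partition xs) = sum (count_list xs) (set xs)"
    by (simp add: mset_value_partition sum_unfold_sum_mset flip: sum_mset_sum_list)
  moreover have "x > 0" if "x \<in> set (value_partition xs)" for x
    using that by (auto simp: value_partition_def count_list_0_iff intro!: Nat.gr0I)
  ultimately show ?thesis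
    by (simp add: partitions_def sorted_value_partition sum_count_set)
qed

lemma value_partition_snoc_old:
  assumes vs: "distinct vs" "set vs = set xs" "value_partition xs = map (count_list xs) vs"
    and i: "i < length vs"
  shows "value_partition (xs @ [vs ! i]) = add_box i (value_partition xs)"
proof (rule partition_eqI)
  let ?x = "vs ! i" and ?\<alpha> = "value_partition xs"
  have part: "?\<alpha> \<in> partitions (length xs)" by (rule value_partition_partition)
  show "sorted_wrt (\<ge>) (add_box i ?\<alpha>)"
    using add_box_partition[OF part] by (simp add: partitions_def)
  have x: "?x \<in> set xs" using i vs(2) nth_mem by blast
  have i': "i < length ?\<alpha>" "?\<alpha> ! i = count_list xs ?x" using vs i by simp_all
  have rest: "image_mset (count_list (xs @ [?x])) (mset_set (set xs - {?x}))
      = image_mset (count_list xs) (mset_set (set xs - {?x}))"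
    by (rule image_mset_cong) auto
  have split: "mset_set (set xs) = add_mset ?x (mset_set (set xs - {?x}))"
    using x by (simp add: mset_set.remove)
  have "set (xs @ [?x]) = set xs" using x by auto
  then have "mset (value_partition (xs @ [?x]))
      = add_mset (Suc (count_list xs ?x)) (image_mset (count_list xs) (mset_set (set xs - {?x})))"
    unfolding mset_value_partition by (simp add: split rest del: set_append)
  also have "\<dots> = mset (add_box i ?\<alpha>)"
    using i' by (simp add: mset_add_box[OF part] mset_value_partition split)
  finally show "mset (value_partition (xs @ [?x])) = mset (add_box i ?\<alpha>)" .
qed (rule sorted_value_partition)

lemma value_partition_snoc_new:
  assumes "x \<notin> set xs" and i: "length (value_partition xs) \<le> i"
  shows "value_partition (xs @ [x]) = add_box i (value_partition xs)"
proof (rule partition_eqI)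
  let ?\<alpha> = "value_partition xs"
  have part: "?\<alpha> \<in> partitions (length xs)" by (rule value_partition_partition)
  show "sorted_wrt (\<ge>) (add_box i ?\<alpha>)"
    using add_box_partition[OF part] by (simp add: partitions_def)
  have rest: "image_mset (count_list (xs @ [x])) (mset_set (set xs))
      = image_mset (count_list xs) (mset_set (set xs))"
    using assms by (intro image_mset_cong) auto
  have "count_list xs x = 0" using assms(1) by (simp add: count_list_0_iff)
  then have "mset (value_partition (xs @ [x])) = add_mset 1 (image_mset (count_list xs) (mset_set (set xs)))"
    unfolding mset_value_partition using assms(1) by (simp add: rest)
  then show "mset (value_partition (xs @ [x])) = mset (add_box i ?\<alpha>)"
    using i by (simp add: mset_add_box[OF part] mset_value_partition)
qed (rule sorted_value_partition)

lemma point_seq_Suc: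
  "n \<ge> 1 \<Longrightarrow> point_seq (Suc n) l (a(Suc n := x)) = point_seq n l a @ [x]"
  by (simp add: point_seq_def)

lemma length_point_seq: "n \<ge> 1 \<Longrightarrow> length (point_seq n l a) = n + l - 1"
  by (auto simp: point_seq_def)

lemma point_partition_partitions_ge:
  assumes "n \<ge> 1" "l \<ge> 1"
  shows "point_partition n l a \<in> partitions_ge n l"
proof -
  let ?xs = "point_seq n l a"
  let ?\<alpha> = "value_partition ?xs"
  have "a 1 \<in> set ?xs" using assms by (simp add: point_seq_def)
  then have "count_list ?xs (a 1) \<in> set ?\<alpha>" by (simp add: value_partition_def)
  moreover have "l \<le> count_list ?xs (a 1)"
    by (simp add: point_seq_def count_list_eq_length_filter)
  moreover have "x \<le> hd ?\<alpha>" if "x \<in> set ?\<alpha>" for x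
    using that sorted_value_partition[of ?xs] by (cases ?\<alpha>) auto
  ultimately have "?\<alpha> \<noteq> []" "l \<le> hd ?\<alpha>" by (auto intro: order_trans)
  then show ?thesis
    using value_partition_partition[of ?xs] length_point_seq[OF assms(1), of l a]
    by (simp add: partitions_ge_def point_partition_eq)
qed

text \<open>The values available for the new coordinate that put a box at row at most \<open>d\<close>. If the point has more than \<open>d\<close>
  distinct values, the \<open>d + 1\<close> most frequent of them will do. Otherwise every field element will: old
  values have an index at most \<open>d\<close>, and a new value adds a row, which \<open>add_box d\<close> does as well.\<close>

lemma many_extensions_add_box:
  fixes a :: "nat \<Rightarrow> 'a"
  assumes inf: "infinite (UNIV :: 'a set)" and n: "n \<ge> 1"
  obtains X where "infinite X \<or> d < card X"
    and "\<And>x. x \<in> X \<Longrightarrow>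
      \<exists>i\<le>d. point_partition (Suc n) l (a(Suc n := x)) = add_box i (point_partition n l a)"
proof -
  let ?xs = "point_seq n l a"
  obtain vs where vs: "distinct vs" "set vs = set ?xs" "value_partition ?xs = map (count_list ?xs) vs"
    by (rule value_partition_obtain)
  note simps = point_partition_eq point_seq_Suc[OF n]
  show ?thesis
  proof (cases "d < length vs")
    case True
    show ?thesis
    proof
      have "card (set (take (Suc d) vs)) = Suc d"
        using vs(1) True by (simp add: distinct_card)
      then show "infinite (set (take (Suc d) vs)) \<or> d < card (set (take (Suc d) vs))" by simp
      fix x assume "x \<in> set (take (Suc d) vs)"
      then obtain i where "i \<le> d" "x = vs ! i"
        using True by (auto simp: in_set_conv_nth less_Suc_eq_le)
      then show "\<exists>i\<le>d. point_partition (Suc n) l (a(Suc n := x)) = add_box i (point_partition n l a)"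
        using value_partition_snoc_old[OF vs, of i] True by (auto simp: simps)
    qed
  next
    case False
    show ?thesis
    proof
      show "infinite (UNIV :: 'a set) \<or> d < card (UNIV :: 'a set)" using inf by simp
      fix x
      show "\<exists>i\<le>d. point_partition (Suc n) l (a(Suc n := x)) = add_box i (point_partition n l a)"
      proof (cases "x \<in> set ?xs")
        case True
        then obtain i where i: "i < length vs" "x = vs ! i" using vs(2) by (metis in_set_conv_nth)
        then show ?thesis
          using value_partition_snoc_old[OF vs i(1)] False by (intro exI[of _ i]) (auto simp: simps)
      next
        case new: False
        then show ?thesis
          using value_partition_snoc_new[OF new, of d] False vs(3) by (intro exI[of _ d]) (auto simp: simps)
      qed
    qed
  qed
qed

section \<open>Specht polynomials\<close>

definition column :: "nat list \<Rightarrow> nat \<Rightarrow> nat set" where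
  "column \<alpha> j = {i. (i, j) \<in> diagram \<alpha>}"

lemma in_diagram_iff: "(i, j) \<in> diagram \<alpha> \<longleftrightarrow> j < part \<alpha> i"
  by (auto simp: diagram_def nth_default_def)

lemma in_column_iff: "i \<in> column \<alpha> j \<longleftrightarrow> j < part \<alpha> i"
  by (simp add: column_def in_diagram_iff)

lemma finite_column [simp]: "finite (column \<alpha> j)"
  by (rule finite_subset[of _ "{..<length \<alpha>}"]) (auto simp: column_def diagram_def)

lemma column_downward: "sorted_wrt (\<ge>) \<alpha> \<Longrightarrow> i' \<in> column \<alpha> j \<Longrightarrow> i \<le> i' \<Longrightarrow> i \<in> column \<alpha> j"
  using part_antimono[of \<alpha> i i'] by (simp add: in_column_iff)

lemma diagram_eq_columns:
  assumes "sorted_wrt (\<ge>) \<alpha>" "\<alpha> \<noteq> []"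
  shows "diagram \<alpha> = prod.swap ` (SIGMA j:{..<hd \<alpha>}. column \<alpha> j)"
proof -
  have "j < hd \<alpha>" if "j < part \<alpha> i" for i j
    using part_antimono[OF assms(1), of 0 i] that hd_eq_part[OF assms(2)] by simp
  then show ?thesis by (force simp: in_diagram_iff in_column_iff)
qed

lemma sum_diagram:
  assumes "sorted_wrt (\<ge>) \<alpha>" "\<alpha> \<noteq> []"
  shows "(\<Sum>(i, j)\<in>diagram \<alpha>. f i j) = (\<Sum>j<hd \<alpha>. \<Sum>i\<in>column \<alpha> j. f i j)"
  unfolding diagram_eq_columns[OF assms]
  by (subst sum.reindex) (simp_all add: sum.Sigma inj_on_def split_def)

lemma finite_diagram [simp]: "finite (diagram \<alpha>)"
proof -
  have "diagram \<alpha> = (SIGMA i:{..<length \<alpha>}. {..<\<alpha> ! i})" by (auto simp: diagram_def)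
  then show ?thesis by simp
qed

text \<open>Each entry is weighted by its row. This is the leading monomial of the Specht polynomial of a
  tableau with strictly increasing columns.\<close>

definition tableau_monom :: "nat list \<Rightarrow> (nat \<times> nat \<Rightarrow> nat) \<Rightarrow> monom" where
  "tableau_monom \<alpha> T = (\<Sum>(i, j)\<in>diagram \<alpha>. single (T (i, j)) i)"

definition column_pairs :: "nat list \<Rightarrow> nat \<Rightarrow> (nat \<times> nat) set" where
  "column_pairs \<alpha> j = {(i, i'). i < i' \<and> (i, j) \<in> diagram \<alpha> \<and> (i', j) \<in> diagram \<alpha>}"

lemma finite_column_pairs [simp]: "finite (column_pairs \<alpha> j)"
  by (rule finite_subset[of _ "column \<alpha> j \<times> column \<alpha> j"]) (auto simp: column_pairs_def in_column_iff in_diagram_iff)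

lemma difference_product_eq:
  "difference_product \<alpha> T j = (\<Prod>(i, i')\<in>column_pairs \<alpha> j. var (T (i, j)) - var (T (i', j)))"
  by (simp add: difference_product_def column_pairs_def)

lemma sum_single_one: "(\<Sum>x\<in>A. single k (1::nat)) = single k (card A)"
  by (induction A rule: infinite_finite_induct) (auto simp: single_add[symmetric])

text \<open>In a factor $x_a - x_b$ with $a < b$ the larger variable $x_b$ leads. The entry in row \<open>i\<close> of a column is
  the larger one in exactly \<open>i\<close> factors, namely those with the entries above it.\<close>

lemma leads_specht:
  fixes \<alpha> :: "nat list"
  assumes \<alpha>: "sorted_wrt (\<ge>) \<alpha>" "\<alpha> \<noteq> []"
    and incr: "\<And>i i' j. (i, j) \<in> diagram \<alpha> \<Longrightarrow> (i', j) \<in> diagram \<alpha> \<Longrightarrow> i < i' \<Longrightarrow> T (i, j) < T (i', j)"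
  shows "leads (specht \<alpha> T :: 'a::field mpoly) (tableau_monom \<alpha> T)"
proof -
  have column: "leads (difference_product \<alpha> T j :: 'a mpoly) (\<Sum>i\<in>column \<alpha> j. single (T (i, j)) i)" for j
  proof -
    have pairs: "column_pairs \<alpha> j = prod.swap ` (SIGMA i':column \<alpha> j. {..<i'})"
      using column_downward[OF \<alpha>(1)] by (force simp: column_pairs_def column_def)
    have "(\<Sum>(i, i')\<in>column_pairs \<alpha> j. single (T (i', j)) (1::nat))
        = (\<Sum>i'\<in>column \<alpha> j. \<Sum>i<i'. single (T (i', j)) 1)"
      unfolding pairs by (subst sum.reindex) (simp_all add: sum.Sigma inj_on_def split_def del: sum_constant)
    also have "\<dots> = (\<Sum>i\<in>column \<alpha> j. single (T (i, j)) i)"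
      unfolding sum_single_one by simp
    finally have sum: "(\<Sum>(i, i')\<in>column_pairs \<alpha> j. single (T (i', j)) (1::nat))
        = (\<Sum>i\<in>column \<alpha> j. single (T (i, j)) i)" .
    have "leads ((\<lambda>(i, i'). var (T (i, j)) - var (T (i', j)) :: 'a mpoly) p)
        ((\<lambda>(i, i'). single (T (i', j)) 1) p)" if "p \<in> column_pairs \<alpha> j" for p
      using that incr by (cases p) (auto simp: column_pairs_def intro!: leads_var_diff[simplified])
    then show ?thesis
      unfolding difference_product_eq sum[symmetric] by (rule leads_prod)
  qed
  have eq: "tableau_monom \<alpha> T = (\<Sum>j<hd \<alpha>. \<Sum>i\<in>column \<alpha> j. single (T (i, j)) i)"
    unfolding tableau_monom_def by (rule sum_diagram[OF \<alpha>])
  show ?thesis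
    unfolding specht_def eq by (rule leads_prod) (rule column)
qed

lemma tableau_content:
  "T \<in> tableaux n l \<alpha> \<Longrightarrow> image_mset T (mset_set (diagram \<alpha>)) = replicate_mset l 1 + mset_set {2..n}"
  unfolding tableaux_def by blast

lemma tableau_extensional: "T \<in> tableaux n l \<alpha> \<Longrightarrow> T \<in> extensional (diagram \<alpha>)"
  unfolding tableaux_def by blast

lemma standard_tableaux_subset: "standard_tableaux n l \<alpha> \<subseteq> tableaux n l \<alpha>"
  unfolding standard_tableaux_def by blast

lemma tableau_entries:
  assumes T: "T \<in> tableaux n l \<alpha>" and n: "n \<ge> 1" and b: "b \<in> diagram \<alpha>"
  shows "T b \<in> {1..n}"
proof -
  have "T b \<in> set_mset (image_mset T (mset_set (diagram \<alpha>)))" using b by simp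
  also have "\<dots> = set_mset (replicate_mset l 1 + mset_set {2..n})"
    by (simp only: tableau_content[OF T])
  also have "\<dots> \<subseteq> {1..n}" using n by (auto split: if_splits)
  finally show ?thesis .
qed

lemma specht_carrier:
  assumes "T \<in> tableaux n l \<alpha>" "n \<ge> 1"
  shows "(specht \<alpha> T :: 'a::field mpoly) \<in> carrier (poly_ring n)"
  unfolding specht_def difference_product_eq
  using tableau_entries[OF assms]
  by (auto simp: column_pairs_def intro!: carrier_prod carrier_diff carrier_var)

lemma finite_standard_tableaux:
  assumes "n \<ge> 1"
  shows "finite (standard_tableaux n l \<alpha>)"
proof (rule finite_subset)
  show "standard_tableaux n l \<alpha> \<subseteq> diagram \<alpha> \<rightarrow>\<^sub>E {1..n}"
  proof
    fix T assume "T \<in> standard_tableaux n l \<alpha>"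
    then have T: "T \<in> tableaux n l \<alpha>" using standard_tableaux_subset by blast
    show "T \<in> diagram \<alpha> \<rightarrow>\<^sub>E {1..n}"
      using tableau_entries[OF T assms] tableau_extensional[OF T] unfolding PiE_iff by blast
  qed
  show "finite (diagram \<alpha> \<rightarrow>\<^sub>E {1..n})" by (intro finite_PiE) auto
qed

lemma finite_partitions: "finite (partitions N)"
proof (rule finite_subset)
  show "partitions N \<subseteq> {xs. set xs \<subseteq> {..N} \<and> length xs \<le> N}"
  proof
    fix \<alpha> assume \<alpha>: "\<alpha> \<in> partitions N"
    then have "sum_list (map (\<lambda>_. 1) \<alpha>) \<le> sum_list (map (\<lambda>x. x) \<alpha>)"
      by (intro sum_list_mono) (auto simp: partitions_def Suc_le_eq)
    then have "length \<alpha> \<le> N" using \<alpha> by (simp add: partitions_def sum_list_triv)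
    moreover have "x \<le> N" if "x \<in> set \<alpha>" for x
      using \<alpha> member_le_sum_list[OF that] by (simp add: partitions_def)
    ultimately show "\<alpha> \<in> {xs. set xs \<subseteq> {..N} \<and> length xs \<le> N}" by auto
  qed
  show "finite {xs. set xs \<subseteq> {..N} \<and> length xs \<le> N}" by (rule finite_lists_length_le) simp
qed

lemma finite_specht_set:
  assumes "F \<subseteq> partitions_ge n l" "n \<ge> 1"
  shows "finite (specht_set n l F :: 'a::field mpoly set)"
proof -
  have "finite F"
    using assms(1) finite_partitions[of "n + l - 1"] by (auto simp: partitions_ge_def intro: finite_subset)
  moreover have "specht_set n l F = (\<Union>\<alpha>\<in>F. specht \<alpha> ` standard_tableaux n l \<alpha> :: 'a mpoly set)"
    by (auto simp: specht_set_def)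
  ultimately show ?thesis using finite_standard_tableaux[OF assms(2)] by simp
qed

lemma sum_list_take_eq_columns:
  assumes \<alpha>: "sorted_wrt (\<ge>) \<alpha>" "\<alpha> \<noteq> []"
  shows "sum_list (take k \<alpha>) = (\<Sum>j<hd \<alpha>. card (column \<alpha> j \<inter> {..<k}))"
proof -
  have row: "{j. j < hd \<alpha> \<and> j < part \<alpha> i} = {..<part \<alpha> i}" for i
    using part_antimono[OF \<alpha>(1), of 0 i] hd_eq_part[OF \<alpha>(2)] by auto
  have "(\<Sum>j<hd \<alpha>. card (column \<alpha> j \<inter> {..<k})) = (\<Sum>j<hd \<alpha>. \<Sum>i<k. if j < part \<alpha> i then 1 else 0)"
    by (intro sum.cong refl) (simp add: sum.If_cases in_column_iff Int_commute Collect_conj_eq column_def in_diagram_iff)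
  also have "\<dots> = (\<Sum>i<k. \<Sum>j<hd \<alpha>. if j < part \<alpha> i then 1 else 0)"
    by (rule sum.swap)
  also have "\<dots> = (\<Sum>i<k. part \<alpha> i)"
    by (intro sum.cong refl) (simp add: sum.If_cases lessThan_def flip: Collect_conj_eq add: row)
  finally show ?thesis by (simp add: sum_list_take)
qed

text \<open>Either the column \<open>C\<close> ends within the first \<open>k\<close> rows and then contributes all of its boxes, or it
  contains all of the first \<open>k\<close> rows.\<close>

lemma card_le_initial_segment:
  assumes "finite C" "\<And>i i'. i' \<in> C \<Longrightarrow> i \<le> i' \<Longrightarrow> i \<in> C" "B \<subseteq> C" "card B \<le> k"
  shows "card B \<le> card (C \<inter> {..<k::nat})"
proof (cases "C \<subseteq> {..<k}")
  case True
  then show ?thesis using assms by (simp add: Int_absorb2 card_mono)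
next
  case False
  then obtain c where "c \<in> C" "k \<le> c" by (meson lessThan_iff not_le subsetI)
  then have "C \<inter> {..<k} = {..<k}" using assms(2)[of c] by auto
  then show ?thesis using assms(4) by simp
qed

text \<open>Substituting the coordinates of \<open>a\<close> into a tableau yields a filling of the diagram by the sequence in which
  the first coordinate is repeated \<open>l\<close> times; so multiplicities can be counted column by column.\<close>

lemma image_point_tableau:
  assumes T: "T \<in> tableaux n l \<alpha>"
  shows "image_mset (\<lambda>b. a (T b)) (mset_set (diagram \<alpha>)) = mset (point_seq n l a)"
proof -
  have "image_mset (\<lambda>b. a (T b)) (mset_set (diagram \<alpha>)) = image_mset a (image_mset T (mset_set (diagram \<alpha>)))"
    by (simp add: image_mset.compositionality o_def)
  also have "\<dots> = image_mset a (replicate_mset l 1 + mset_set {2..n})"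
    by (simp only: tableau_content[OF T])
  also have "mset_set {2..n} = mset [2..<Suc n]"
    by (metis atLeastLessThanSuc_atLeastAtMost mset_upt)
  finally show ?thesis by (simp add: point_seq_def del: mset_upt upt_Suc)
qed

text \<open>If the value is nonzero, the coordinates in each column are pairwise distinct. So \<open>k\<close> values occupy at most
  \<open>k\<close> boxes of each column, hence no more boxes than the column has in the first \<open>k\<close> rows.
  Summing over the columns and taking the \<open>k\<close> most frequent values compares the partial sums.\<close>

lemma specht_nonzero_dominates:
  assumes T: "T \<in> tableaux n l \<alpha>" and \<alpha>: "\<alpha> \<in> partitions_ge n l"
    and ne: "eval (specht \<alpha> T :: 'a::field mpoly) a \<noteq> 0"
  shows "dominates \<alpha> (point_partition n l a)"
proof -
  let ?xs = "point_seq n l a"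
  have sorted: "sorted_wrt (\<ge>) \<alpha>" and nonempty: "\<alpha> \<noteq> []"
    using \<alpha> by (simp_all add: partitions_ge_def partitions_def)
  have distinct_column: "inj_on (\<lambda>i. a (T (i, j))) (column \<alpha> j)" if "j < hd \<alpha>" for j
  proof (rule linorder_inj_onI')
    fix i i' assume "i \<in> column \<alpha> j" "i' \<in> column \<alpha> j" "i < i'"
    then have "(i, i') \<in> column_pairs \<alpha> j" by (simp add: column_pairs_def column_def)
    moreover have "\<forall>p\<in>column_pairs \<alpha> j. eval ((\<lambda>(i, i'). var (T (i, j)) - var (T (i', j)) :: 'a mpoly) p) a \<noteq> 0"
      using ne that unfolding specht_def difference_product_eq by (simp add: eval_prod)
    ultimately show "a (T (i, j)) \<noteq> a (T (i', j))"
      by (auto simp: eval_diff)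
  qed
  obtain vs where vs: "distinct vs" "set vs = set ?xs" "value_partition ?xs = map (count_list ?xs) vs"
    by (rule value_partition_obtain)
  have "sum_list (take k (value_partition ?xs)) \<le> sum_list (take k \<alpha>)" for k
  proof -
    let ?A = "set (take k vs)"
    have "sum_list (take k (value_partition ?xs)) = (\<Sum>v\<in>?A. count_list ?xs v)"
      using vs by (simp add: take_map sum_list_distinct_conv_sum_set)
    also have "\<dots> = (\<Sum>v\<in>?A. card {b \<in> diagram \<alpha>. a (T b) = v})"
    proof (rule sum.cong[OF refl])
      fix v
      have "count_list ?xs v = count (image_mset (\<lambda>b. a (T b)) (mset_set (diagram \<alpha>))) v"
        using image_point_tableau[OF T, of a] by (simp add: count_mset)
      also have "\<dots> = card {b \<in> diagram \<alpha>. a (T b) = v}"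
        by (simp add: count_image_mset vimage_def Int_def conj_commute)
      finally show "count_list ?xs v = card {b \<in> diagram \<alpha>. a (T b) = v}" .
    qed
    also have "\<dots> = (\<Sum>v\<in>?A. \<Sum>b\<in>diagram \<alpha>. if a (T b) = v then 1 else 0)"
      by (simp add: sum.If_cases Int_def)
    also have "\<dots> = (\<Sum>b\<in>diagram \<alpha>. if a (T b) \<in> ?A then 1 else 0)"
      by (subst sum.swap) simp
    also have "\<dots> = (\<Sum>j<hd \<alpha>. \<Sum>i\<in>column \<alpha> j. if a (T (i, j)) \<in> ?A then 1 else 0)"
      using sum_diagram[OF sorted nonempty, of "\<lambda>i j. if a (T (i, j)) \<in> ?A then 1 else 0"]
      by (simp add: split_def)
    also have "\<dots> = (\<Sum>j<hd \<alpha>. card {i \<in> column \<alpha> j. a (T (i, j)) \<in> ?A})"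
      by (simp add: sum.If_cases Int_def)
    also have "\<dots> \<le> (\<Sum>j<hd \<alpha>. card (column \<alpha> j \<inter> {..<k}))"
    proof (rule sum_mono)
      fix j assume j: "j \<in> {..<hd \<alpha>}"
      let ?B = "{i \<in> column \<alpha> j. a (T (i, j)) \<in> ?A}"
      have "card ?B \<le> card ?A"
        by (rule card_inj_on_le[of "\<lambda>i. a (T (i, j))"])
           (use distinct_column[of j] j in \<open>auto intro: inj_on_subset\<close>)
      also have "\<dots> \<le> k" by (rule order_trans[OF card_length]) simp
      finally show "card ?B \<le> card (column \<alpha> j \<inter> {..<k})"
        using column_downward[OF sorted] by (intro card_le_initial_segment) auto
    qed
    also have "\<dots> = sum_list (take k \<alpha>)"
      by (rule sum_list_take_eq_columns[OF sorted nonempty, symmetric])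
    finally show ?thesis .
  qed
  then show ?thesis by (simp add: dominates_def point_partition_eq)
qed

lemma specht_set_subset_vanishing_ideal:
  assumes F: "lower_filter n l F" and n: "n \<ge> 1" "l \<ge> 1"
  shows "(specht_set n l F :: 'a::field mpoly set) \<subseteq> vanishing_ideal n l (partitions_ge n l - F)"
proof
  fix f :: "'a mpoly" assume "f \<in> specht_set n l F"
  then obtain \<alpha> T where f: "f = specht \<alpha> T" and \<alpha>: "\<alpha> \<in> F" and T: "T \<in> tableaux n l \<alpha>"
    using standard_tableaux_subset unfolding specht_set_def by blast
  have "\<alpha> \<in> partitions_ge n l" using F \<alpha> by (auto simp: lower_filter_def)
  then have "eval f a = 0" if "point_partition n l a \<in> partitions_ge n l - F" for a
    using specht_nonzero_dominates[OF T, of a] F \<alpha> that unfolding f lower_filter_def by blast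
  then show "f \<in> vanishing_ideal n l (partitions_ge n l - F)"
    using specht_carrier[OF T n(1)] by (auto simp: vanishing_ideal_def f)
qed

section \<open>Standard tableaux below a leading monomial\<close>

lemma diagram_add_box:
  "diagram (add_box i \<alpha>) = insert (corner \<alpha> i, part \<alpha> i) (diagram \<alpha>)"
  by (auto simp: in_diagram_iff part_add_box part_corner split: if_splits)

lemma corner_box_notin_diagram: "(corner \<alpha> i, part \<alpha> i) \<notin> diagram \<alpha>"
  by (simp add: in_diagram_iff part_corner)

text \<open>The largest entry fits into any addable corner. There it contributes its row number to the
  exponent of the new variable.\<close>

lemma standard_tableau_add_box:
  fixes d :: nat
  assumes T: "T \<in> standard_tableaux n l \<alpha>" and \<alpha>: "sorted_wrt (\<ge>) \<alpha>" and n: "n \<ge> 1"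
  defines "T' \<equiv> T((corner \<alpha> d, part \<alpha> d) := Suc n)"
  shows "T' \<in> standard_tableaux (Suc n) l (add_box d \<alpha>)"
    and "tableau_monom (add_box d \<alpha>) T' = tableau_monom \<alpha> T + single (Suc n) (corner \<alpha> d)"
proof -
  let ?b = "(corner \<alpha> d, part \<alpha> d)"
  have new: "?b \<notin> diagram \<alpha>" by (rule corner_box_notin_diagram)
  have T'_new: "T' ?b = Suc n" and T'_old: "T' b = T b" if "b \<in> diagram \<alpha>" for b
    using that new by (auto simp: T'_def)
  have T: "T \<in> tableaux n l \<alpha>"
    and cols: "(i, j) \<in> diagram \<alpha> \<Longrightarrow> (i', j) \<in> diagram \<alpha> \<Longrightarrow> i < i' \<Longrightarrow> T (i, j) < T (i', j)"
    and rows: "(i, j) \<in> diagram \<alpha> \<Longrightarrow> (i, j') \<in> diagram \<alpha> \<Longrightarrow> j < j' \<Longrightarrow> T (i, j) \<le> T (i, j')" for i i' j j'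
    using T unfolding standard_tableaux_def by blast+
  have le: "T b \<le> n" if "b \<in> diagram \<alpha>" for b
    using tableau_entries[OF T n that] by simp
  have below: "(i, part \<alpha> d) \<notin> diagram \<alpha>" if "corner \<alpha> d < i" for i
    using part_antimono[OF \<alpha>, of "corner \<alpha> d" i] that by (simp add: in_diagram_iff part_corner)
  have right: "(corner \<alpha> d, j) \<notin> diagram \<alpha>" if "part \<alpha> d < j" for j
    using that by (simp add: in_diagram_iff part_corner)
  have "image_mset T' (mset_set (insert ?b (diagram \<alpha>))) = add_mset (Suc n) (image_mset T (mset_set (diagram \<alpha>)))"
  proof -
    have "image_mset T' (mset_set (diagram \<alpha>)) = image_mset T (mset_set (diagram \<alpha>))"
      by (rule image_mset_cong) (simp add: T'_old)
    then show ?thesis using new by (simp add: T'_def)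
  qed
  also have "\<dots> = replicate_mset l 1 + mset_set {2..Suc n}"
    unfolding tableau_content[OF T] using n by (simp add: atLeastAtMostSuc_conv)
  finally have content: "image_mset T' (mset_set (diagram (add_box d \<alpha>))) = replicate_mset l 1 + mset_set {2..Suc n}"
    by (simp add: diagram_add_box)
  have ext: "T' \<in> extensional (diagram (add_box d \<alpha>))"
    using tableau_extensional[OF T] by (auto simp: extensional_def diagram_add_box T'_def)
  have cols': "T' (i, j) < T' (i', j)"
    if "(i, j) \<in> diagram (add_box d \<alpha>)" "(i', j) \<in> diagram (add_box d \<alpha>)" "i < i'" for i i' j
    using that below[of i'] cols[of i j i'] le[of "(i, j)"] unfolding diagram_add_box
    by (auto simp: T'_def less_Suc_eq_le)
  have rows': "T' (i, j) \<le> T' (i, j')"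
    if "(i, j) \<in> diagram (add_box d \<alpha>)" "(i, j') \<in> diagram (add_box d \<alpha>)" "j < j'" for i j j'
    using that right[of j'] rows[of i j j'] le[of "(i, j)"] unfolding diagram_add_box
    by (auto simp: T'_def le_Suc_eq)
  have ones: "i = i'"
    if "(i, j) \<in> diagram (add_box d \<alpha>)" "(i', j) \<in> diagram (add_box d \<alpha>)" "T' (i, j) = 1" "T' (i', j) = 1" for i i' j
    using that cols'[of i j i'] cols'[of i' j i] by (cases i i' rule: linorder_cases) auto
  show "T' \<in> standard_tableaux (Suc n) l (add_box d \<alpha>)"
    unfolding standard_tableaux_def tableaux_def using content ext cols' rows' ones by blast
  have "(\<Sum>(i, j)\<in>diagram \<alpha>. single (T' (i, j)) i) = (\<Sum>(i, j)\<in>diagram \<alpha>. single (T (i, j)) i)"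
    by (rule sum.cong) (auto simp: T'_old)
  then show "tableau_monom (add_box d \<alpha>) T' = tableau_monom \<alpha> T + single (Suc n) (corner \<alpha> d)"
    unfolding tableau_monom_def diagram_add_box using new by (simp add: T'_def add.commute)
qed

text \<open>Take a point whose shape \<open>\<alpha>\<close> is outside the residual filter, so that \<open>add_box d \<alpha>\<close> is outside \<open>F\<close>. A box
  in a higher row gives a dominating shape, which is again outside the lower filter \<open>F\<close>. Hence \<open>f\<close> vanishes at all
  extensions provided by \<open>many_extensions_add_box\<close>, which are too many roots for degree \<open>d\<close>.\<close>

lemma last_coeff_in_vanishing_ideal:
  fixes f :: "'a::field mpoly"
  assumes inf: "infinite (UNIV :: 'a set)" and n: "n \<ge> 1" "l \<ge> 1"
    and F: "lower_filter (Suc n) l F"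
    and f: "f \<in> vanishing_ideal (Suc n) l (partitions_ge (Suc n) l - F)"
    and m: "leads f m"
  defines "d \<equiv> lookup m (Suc n)"
  shows "last_coeff (Suc n) d f
    \<in> vanishing_ideal n l (partitions_ge n l - box_residual n l d F)"
proof -
  have fc: "f \<in> carrier (poly_ring (Suc n))" using f by (simp add: vanishing_ideal_def)
  have "eval (last_coeff (Suc n) d f) a = 0"
    if a: "a \<in> {1..n} \<rightarrow>\<^sub>E UNIV" and out: "point_partition n l a \<in> partitions_ge n l - box_residual n l d F" for a
  proof -
    let ?\<alpha> = "point_partition n l a"
    have \<alpha>: "?\<alpha> \<in> partitions_ge n l" "add_box d ?\<alpha> \<notin> F" using out by (auto simp: box_residual_def)
    have out': "add_box i ?\<alpha> \<in> partitions_ge (Suc n) l - F" if "i \<le> d" for i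
    proof -
      have "dominates (add_box i ?\<alpha>) (add_box d ?\<alpha>)"
        using \<alpha>(1) that by (intro dominates_add_box_antimono) (auto simp: partitions_ge_def)
      then show ?thesis
        using F \<alpha> add_box_partitions_ge[OF \<alpha>(1) n(2)] unfolding lower_filter_def by blast
    qed
    obtain X where X: "infinite X \<or> d < card X"
      and ext: "\<And>x. x \<in> X \<Longrightarrow> \<exists>i\<le>d. point_partition (Suc n) l (a(Suc n := x)) = add_box i ?\<alpha>"
      using many_extensions_add_box[OF inf n(1)] by metis
    have "eval f (a(Suc n := x)) = 0" if "x \<in> X" for x
    proof -
      have "a(Suc n := x) \<in> {1..Suc n} \<rightarrow>\<^sub>E UNIV" using a by (auto simp: PiE_iff extensional_def)
      moreover have "point_partition (Suc n) l (a(Suc n := x)) \<in> partitions_ge (Suc n) l - F"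
        using ext[OF that] out' by metis
      ultimately show ?thesis using f unfolding vanishing_ideal_def by blast
    qed
    then show ?thesis using last_coeff_vanishes[OF fc m, of X a] X unfolding d_def by blast
  qed
  then show ?thesis using last_coeff_carrier[OF fc] by (simp add: vanishing_ideal_def)
qed

lemma partitions_ge_1: "l \<ge> 1 \<Longrightarrow> partitions_ge 1 l = {[l]}"
proof -
  assume l: "l \<ge> 1"
  have "\<alpha> = [l]" if "\<alpha> \<in> partitions_ge 1 l" for \<alpha>
  proof -
    have "\<alpha> \<noteq> []" "l \<le> hd \<alpha>" "sum_list \<alpha> = l" "\<forall>x\<in>set \<alpha>. 0 < x"
      using that by (auto simp: partitions_ge_def partitions_def)
    then show ?thesis by (cases \<alpha>; cases "tl \<alpha>") auto
  qed
  moreover have "[l] \<in> partitions_ge 1 l" using l by (simp add: partitions_ge_def partitions_def)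
  ultimately show ?thesis by blast
qed

text \<open>In one variable the only shape is a single row. If it is not in \<open>F\<close>, then \<open>f\<close> vanishes on the whole
  infinite line, which is impossible for a polynomial with a leading monomial. If it is, the
  row of ones has the trivial monomial.\<close>

lemma leading_monomial_above_tableau_1:
  fixes f :: "'a::field mpoly"
  assumes inf: "infinite (UNIV :: 'a set)" and l: "l \<ge> 1"
    and f: "f \<in> vanishing_ideal 1 l (partitions_ge 1 l - F)" and m: "leads f m"
  shows "\<exists>T \<in> standard_tableaux 1 l [l]. [l] \<in> F \<and> tableau_monom [l] T = 0"
proof -
  have "[l] \<in> F"
  proof (rule ccontr)
    assume out: "[l] \<notin> F"
    have fc: "f \<in> carrier (poly_ring (Suc 0))" using f by (simp add: vanishing_ideal_def)
    \<comment> \<open>Points are extensional, so the only point of the affine space of dimension 0 has this form.\<close>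
    let ?a = "\<lambda>_. undefined :: 'a"
    let ?d = "lookup m (Suc 0)"
    have "eval f (?a(Suc 0 := x)) = 0" for x
    proof -
      have "?a(Suc 0 := x) \<in> {1..1} \<rightarrow>\<^sub>E UNIV" by (auto simp: PiE_iff extensional_def)
      moreover have "point_partition 1 l (?a(Suc 0 := x)) \<in> partitions_ge 1 l - F"
        using point_partition_partitions_ge[of 1 l "?a(Suc 0 := x)"] out l
        unfolding partitions_ge_1[OF l] by auto
      ultimately show ?thesis using f unfolding vanishing_ideal_def by blast
    qed
    then have zero: "eval (last_coeff (Suc 0) ?d f) ?a = 0"
      using inf by (intro last_coeff_vanishes[OF fc m, of UNIV]) auto
    let ?c = "last_coeff (Suc 0) ?d f"
    have lead: "leads ?c (m - single (Suc 0) ?d)" using m by (rule leads_last_coeff)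
    have "x = 0" if "x \<in> keys ?c" for x
    proof -
      have "keys x = {}" using last_coeff_carrier[OF fc, of ?d] that by (auto simp: carrier_poly_ring)
      then show ?thesis by simp
    qed
    moreover have "keys ?c \<noteq> {}" using lead by (auto simp: leads_def)
    ultimately have "keys ?c = {0}" by blast
    then have "eval ?c ?a = lookup ?c 0" "lookup ?c 0 \<noteq> 0"
      by (simp_all add: eval_altdef monom_eval_def in_keys_iff[symmetric])
    then show False using zero by simp
  qed
  let ?T = "\<lambda>b. if b \<in> diagram [l] then 1 else undefined :: nat"
  have diagram: "diagram [l] = {0} \<times> {..<l}" by (auto simp: diagram_def)
  have "image_mset ?T (mset_set (diagram [l])) = image_mset (\<lambda>_. 1) (mset_set (diagram [l]))"
    by (rule image_mset_cong) simp
  also have "\<dots> = replicate_mset l 1" by (simp add: diagram image_mset_const_eq)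
  finally have "?T \<in> standard_tableaux 1 l [l]"
    unfolding standard_tableaux_def tableaux_def by (auto simp: diagram extensional_def)
  moreover have "tableau_monom [l] ?T = 0"
    unfolding tableau_monom_def by (rule sum.neutral) (auto simp: diagram)
  ultimately show ?thesis using \<open>[l] \<in> F\<close> by blast
qed

text \<open>Induction on the number of variables. The leading coefficient of \<open>f\<close> in the last variable falls under the
  residual filter, so its leading monomial is a multiple of a tableau monomial. The box with the new
  entry lands in a row \<open>\<le> d\<close>, and therefore the power $x_{n+1}^d$ pays for it.\<close>

lemma leading_monomial_above_tableau:
  fixes f :: "'a::field mpoly"
  assumes inf: "infinite (UNIV :: 'a set)" and l: "l \<ge> 1" and "n \<ge> 1"
    and "lower_filter n l F" "f \<in> vanishing_ideal n l (partitions_ge n l - F)" "leads f m"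
  shows "\<exists>\<alpha>\<in>F. \<exists>T\<in>standard_tableaux n l \<alpha>. \<exists>r. m = tableau_monom \<alpha> T + r"
  using assms(3-6)
proof (induction n arbitrary: F f m rule: dec_induct)
  case base
  then show ?case
    using leading_monomial_above_tableau_1[OF inf l] by (metis add_0)
next
  case (step n)
  let ?d = "lookup m (Suc n)"
  let ?R = "box_residual n l ?d F"
  have n: "n \<ge> 1" using step.hyps by simp
  have "leads (last_coeff (Suc n) ?d f) (m - single (Suc n) ?d)"
    using step.prems(3) by (rule leads_last_coeff)
  then obtain \<alpha> T r where \<alpha>: "\<alpha> \<in> ?R" and T: "T \<in> standard_tableaux n l \<alpha>"
    and r: "m - single (Suc n) ?d = tableau_monom \<alpha> T + r"
    using step.IH[OF lower_filter_box_residual[OF step.prems(1) l]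
        last_coeff_in_vanishing_ideal[OF inf n l step.prems]] by blast
  have sorted: "sorted_wrt (\<ge>) \<alpha>"
    using \<alpha> by (simp add: box_residual_def partitions_ge_def partitions_def)
  let ?T' = "T((corner \<alpha> ?d, part \<alpha> ?d) := Suc n)"
  have "m = (m - single (Suc n) ?d) + single (Suc n) ?d" by (simp add: minus_single_add)
  \<comment> \<open>The excess of \<open>d\<close> over the actual row of the new box goes into the cofactor.\<close>
  also have "\<dots> = tableau_monom \<alpha> T + r + single (Suc n) (corner \<alpha> ?d + (?d - corner \<alpha> ?d))"
    using corner_le[of \<alpha> ?d] by (simp add: r)
  also have "\<dots> = tableau_monom (add_box ?d \<alpha>) ?T' + (r + single (Suc n) (?d - corner \<alpha> ?d))"
    unfolding single_add standard_tableau_add_box(2)[OF T sorted n] by (simp add: add_ac)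
  finally show ?case
    using \<alpha> standard_tableau_add_box(1)[OF T sorted n, of ?d] by (auto simp: box_residual_def)
qed

theorem theorem2p6:
  fixes n l :: nat and F :: "nat list set"
  assumes "infinite (UNIV :: 'a::field set)"
    and "n \<ge> 1" and "l \<ge> 1"
    and "lower_filter n l F" and "F \<noteq> partitions_ge n l"
  shows "groebner_basis n (specht_set n l F :: 'a mpoly set)
           (vanishing_ideal n l (partitions_ge n l - F))"
proof -
  let ?R = "poly_ring n :: 'a mpoly ring"
  let ?G = "specht_set n l F :: 'a mpoly set"
  let ?J = "vanishing_ideal n l (partitions_ge n l - F) :: 'a mpoly set"
  interpret cring ?R by (rule cring_poly_ring)
  have F: "F \<subseteq> partitions_ge n l" using assms by (simp add: lower_filter_def)
  have GJ: "?G \<subseteq> ?J" using assms by (intro specht_set_subset_vanishing_ideal)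
  have keys_le: "keys r \<subseteq> keys (s + r)" for r s :: monom
    by (auto simp: in_keys_iff lookup_add)
  have J_carrier: "initial_monoms ?J \<subseteq> carrier ?R"
  proof
    fix x assume "x \<in> initial_monoms ?J"
    then obtain f where f: "f \<in> ?J" "f \<noteq> 0" "x = single (lead_monom f) 1"
      by (auto simp: initial_monoms_def)
    then show "x \<in> carrier ?R"
      using leads_lead_monom[OF f(2)] by (auto simp: vanishing_ideal_def carrier_poly_ring leads_def)
  qed
  have sub: "initial_monoms ?G \<subseteq> initial_monoms ?J" using GJ by (auto simp: initial_monoms_def)
  then have G_carrier: "initial_monoms ?G \<subseteq> carrier ?R" using J_carrier by blast
  have ideal_G: "ideal (genideal ?R (initial_monoms ?G)) ?R" using G_carrier by (rule genideal_ideal)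
  have "initial_monoms ?J \<subseteq> genideal ?R (initial_monoms ?G)"
  proof
    fix x assume x: "x \<in> initial_monoms ?J"
    then obtain f where f: "f \<in> ?J" "f \<noteq> 0" "x = single (lead_monom f) 1"
      by (auto simp: initial_monoms_def)
    obtain \<alpha> T r where \<alpha>: "\<alpha> \<in> F" and T: "T \<in> standard_tableaux n l \<alpha>"
      and m: "lead_monom f = tableau_monom \<alpha> T + r"
      using leading_monomial_above_tableau[OF assms(1,3,2,4) f(1) leads_lead_monom[OF f(2)]] by blast
    have lead: "leads (specht \<alpha> T :: 'a mpoly) (tableau_monom \<alpha> T)"
      proof (rule leads_specht)
      show "sorted_wrt (\<ge>) \<alpha>" "\<alpha> \<noteq> []"
        using \<alpha> F by (auto simp: partitions_ge_def partitions_def)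
    qed (use T in \<open>unfold standard_tableaux_def, blast\<close>)
    have "(specht \<alpha> T :: 'a mpoly) \<in> ?G" using \<alpha> T by (auto simp: specht_set_def)
    then have "single (tableau_monom \<alpha> T) (1::'a) \<in> initial_monoms ?G"
      using lead_monom_eq[OF lead] leads_nonzero[OF lead] unfolding initial_monoms_def by force
    then have "single (tableau_monom \<alpha> T) (1::'a) \<in> genideal ?R (initial_monoms ?G)"
      using genideal_self[OF G_carrier] by blast
    moreover have "single r (1::'a) \<in> carrier ?R"
    proof (rule carrier_single)
      have "keys (tableau_monom \<alpha> T + r) \<subseteq> {1..n}"
        using subsetD[OF J_carrier x] by (simp add: f(3) m carrier_poly_ring)
      then show "keys r \<subseteq> {1..n}" using keys_le by blast
    qed
    ultimately have "single r 1 * single (tableau_monom \<alpha> T) (1::'a) \<in> genideal ?R (initial_monoms ?G)"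
      using ideal.I_l_closed[OF ideal_G] by simp
    then show "x \<in> genideal ?R (initial_monoms ?G)"
      by (simp add: f(3) m mult_single add.commute)
  qed
  then have "genideal ?R (initial_monoms ?J) \<subseteq> genideal ?R (initial_monoms ?G)"
    using ideal_G by (intro genideal_minimal)
  moreover have "genideal ?R (initial_monoms ?G) \<subseteq> genideal ?R (initial_monoms ?J)"
    using sub genideal_self[OF J_carrier] genideal_ideal[OF J_carrier] by (intro genideal_minimal) auto
  ultimately show ?thesis
    using finite_specht_set[OF F assms(2)] GJ ideal_vanishing_ideal unfolding groebner_basis_def by blast
qed

end
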